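(* Let $E$ be a real Banach lattice and let $S$ be a positive and irreducible semigroup on $E$ with growth bound $\omega_0(S)=0$. If $S$ is asymptotically compact, then there exist a quasi-interior point $u\in E_+$ and a strictly positive functional $\varphi\in E'$ such that $S(t)$ converges with respect to the operator norm to the operator $\varphi\otimes u$ (defined by $f\mapsto\langle\varphi,f\rangle u$) as $t\to\infty$.
   Context: A semigroup on $E$ is a map $S:(0,\infty)\to\mathcal{L}(E)$ with $S(s+t)=S(t)S(s)$ for all $s,t>0$ and $\sup_{t\in(0,1]}\|S(t)\|<\infty$; no time continuity is assumed. $S$ is positive if each $S(t)$ maps $E_+$ into $E_+$. A positive semigroup is irreducible if for every $0<f\in E$ and every $0<\varphi\in E'$ (where $0<x$ means $x\ge0$, $x\neq0$) there exists $t>0$ with $\langle\varphi,S(t)f\rangle>0$. The growth bound is $\omega_0(S)=\inf\{w\in\mathbb{R}:\ \exists M\ge0 \text{ with } \|S(t)\|\le Me^{wt}\ \forall t>0\}$. The essential norm of $R\in\mathcal{L}(E)$ is $\|R\|_{\mathrm{ess}}=\inf\{\|R-K\|:\ K \text{ compact}\}$; $S$ is asymptotically compact if $\lim_{t\to\infty}\|S(t)\|_{\mathrm{ess}}=0$ (equivalently, $\|S(t)\|_{\mathrm{ess}}<1$ for some $t>0$). A vector $u\in E_+$ is a quasi-interior point if $\lim_{n\to\infty}v\wedge(nu)=v$ for all $v\in E_+$; $\varphi\in E'$ is strictly positive if $\langle\varphi,f\rangle>0$ for all $0<f\in E$. *)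

theory Defs
  imports "HOL-Analysis.Analysis"
begin

class banach_lattice = banach + ordered_real_vector + lattice +
  assumes lattice_norm: "sup x (- x) \<le> sup y (- y) \<Longrightarrow> norm x \<le> norm y"

text \<open>Semigroup on E (no time continuity assumed).\<close>
definition op_semigroup :: "(real \<Rightarrow> ('a::real_normed_vector \<Rightarrow>\<^sub>L 'a)) \<Rightarrow> bool" where
  "op_semigroup S \<longleftrightarrow>
     (\<forall>s>0. \<forall>t>0. S (s + t) = S t o\<^sub>L S s) \<and>
     bdd_above ((\<lambda>t. norm (S t)) ` {0<..1})"

definition positive_functional :: "('a::banach_lattice \<Rightarrow>\<^sub>L real) \<Rightarrow> bool" where
  "positive_functional \<phi> \<longleftrightarrow> (\<forall>f. 0 \<le> f \<longrightarrow> 0 \<le> \<phi> f)"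

definition strictly_positive_functional :: "('a::banach_lattice \<Rightarrow>\<^sub>L real) \<Rightarrow> bool" where
  "strictly_positive_functional \<phi> \<longleftrightarrow> (\<forall>f. 0 \<le> f \<and> f \<noteq> 0 \<longrightarrow> 0 < \<phi> f)"

definition positive_semigroup :: "(real \<Rightarrow> ('a::banach_lattice \<Rightarrow>\<^sub>L 'a)) \<Rightarrow> bool" where
  "positive_semigroup S \<longleftrightarrow> (\<forall>t>0. \<forall>f. 0 \<le> f \<longrightarrow> 0 \<le> S t f)"

definition irreducible_semigroup :: "(real \<Rightarrow> ('a::banach_lattice \<Rightarrow>\<^sub>L 'a)) \<Rightarrow> bool" where
  "irreducible_semigroup S \<longleftrightarrow>
     (\<forall>f \<phi>. 0 \<le> f \<and> f \<noteq> 0 \<and> positive_functional \<phi> \<and> \<phi> \<noteq> 0 \<longrightarrow>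
        (\<exists>t>0. 0 < \<phi> (S t f)))"

text \<open>Growth bound, as an extended real (it may be \<open>-\<infinity>\<close>).\<close>
definition growth_bound :: "(real \<Rightarrow> ('a::real_normed_vector \<Rightarrow>\<^sub>L 'a)) \<Rightarrow> ereal" where
  "growth_bound S = Inf {ereal w | w. \<exists>M\<ge>0. \<forall>t>0. norm (S t) \<le> M * exp (w * t)}"

definition compact_operator :: "('a::real_normed_vector \<Rightarrow>\<^sub>L 'b::real_normed_vector) \<Rightarrow> bool" where
  "compact_operator K \<longleftrightarrow> compact (closure (blinfun_apply K ` ball 0 1))"

definition ess_norm :: "('a::real_normed_vector \<Rightarrow>\<^sub>L 'b::real_normed_vector) \<Rightarrow> real" where
  "ess_norm R = Inf {norm (R - K) | K. compact_operator K}"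

definition asymptotically_compact :: "(real \<Rightarrow> ('a::real_normed_vector \<Rightarrow>\<^sub>L 'a)) \<Rightarrow> bool" where
  "asymptotically_compact S \<longleftrightarrow> ((\<lambda>t. ess_norm (S t)) \<longlongrightarrow> 0) at_top"

definition quasi_interior :: "'a::banach_lattice \<Rightarrow> bool" where
  "quasi_interior u \<longleftrightarrow> 0 \<le> u \<and> (\<forall>v. 0 \<le> v \<longrightarrow> (\<lambda>n. inf v (real n *\<^sub>R u)) \<longlonglongrightarrow> v)"

definition rank_one :: "('a::real_normed_vector \<Rightarrow>\<^sub>L real) \<Rightarrow> 'b::real_normed_vector \<Rightarrow> ('a \<Rightarrow>\<^sub>L 'b)" where
  "rank_one \<phi> u = Blinfun (\<lambda>f. \<phi> f *\<^sub>R u)"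

end

theory Submission
  imports Defs "HOL-Library.Lattice_Algebras"
begin

text \<open>
  Since \<open>S t = S s \<circ> S (t - 2 s) \<circ> S s\<close> and \<open>S s\<close> is almost compact for large \<open>s\<close>, suitably normalised
  families \<open>S (t n)\<close>, \<open>t n \<rightarrow> \<infinity>\<close>, are relatively compact in operator norm. This first yields that \<open>S\<close>
  is bounded: otherwise a normalised limit would be a nonzero positive operator with square zero that
  commutes with \<open>S\<close>, which irreducibility forbids. Hence the norm limit points of \<open>S t\<close> at infinity form
  a group, whose unit \<open>P\<close> is a strictly positive projection; its range \<open>F\<close> is a sublattice on which every
  \<open>S t\<close> acts as a lattice isomorphism. The image of the unit ball under \<open>P\<close> is totally bounded and
  disjoint unit vectors have distance at least one, so \<open>F\<close> contains atoms and only boundedly many of them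
  are pairwise disjoint. As every \<open>S t\<close> has roots of all orders, it cannot permute atoms nontrivially; being
  bounded in both time directions, it fixes them. By irreducibility a fixed atom is quasi-interior, which
  leaves room for no further atom. So \<open>F\<close> is one-dimensional, \<open>S t \<circ> P = P\<close>, and \<open>P\<close> is the only limit
  point of \<open>S\<close>.
\<close>

section \<open>Banach lattices\<close>

subclass (in banach_lattice) lattice_ab_group_add ..

lemma norm_mono_nonneg:
  fixes x y :: "'a::banach_lattice"
  assumes "0 \<le> x" "x \<le> y"
  shows "norm x \<le> norm y"
proof (rule lattice_norm)
  have "sup x (- x) = x"
    using assms(1) by (meson le_minus_self_iff minus_le_self_iff sup.absorb1)
  thus "sup x (- x) \<le> sup y (- y)" using assms by (simp add: le_supI1)
qed

lemma norm_pprt_le: "norm (pprt x) \<le> norm (x::'a::banach_lattice)"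
proof (rule lattice_norm)
  have 1: "sup (pprt x) (- pprt x) = pprt x"
    by (meson minus_le_self_iff sup.absorb1 zero_le_pprt)
  have "x + - x \<le> sup x (- x) + sup x (- x)" by (intro add_mono) auto
  hence "0 \<le> sup x (- x)" by simp
  thus "sup (pprt x) (- pprt x) \<le> sup x (- x)"
    unfolding 1 unfolding pprt_def by simp
qed

text \<open>\<open>pprt (- l)\<close> lies below \<open>pprt (x n - l)\<close>, whose norm tends to
  0.\<close>

lemma tendsto_nonneg:
  fixes x :: "nat \<Rightarrow> 'a::banach_lattice"
  assumes "x \<longlonglongrightarrow> l" "\<And>n. 0 \<le> x n"
  shows "0 \<le> l"
proof -
  have "norm (pprt (- l)) \<le> norm (x n - l)" for n
  proof -
    have "pprt (- l) \<le> pprt (x n - l)" using assms(2)[of n] by (intro pprt_mono) simp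
    thus ?thesis by (meson norm_mono_nonneg norm_pprt_le order_trans zero_le_pprt)
  qed
  moreover have "(\<lambda>n. norm (x n - l)) \<longlonglongrightarrow> 0"
    using assms(1) by (simp add: LIM_zero tendsto_norm_zero)
  ultimately have "norm (pprt (- l)) \<le> 0"
    by (meson LIMSEQ_le_const)
  thus ?thesis using le_zero_iff_zero_pprt[of "- l"] by simp
qed

lemma tendsto_lattice_mono:
  fixes x y :: "nat \<Rightarrow> 'a::banach_lattice"
  assumes "x \<longlonglongrightarrow> l" "y \<longlonglongrightarrow> m" "\<And>n. x n \<le> y n"
  shows "l \<le> m"
  using tendsto_nonneg[of "\<lambda>n. y n - x n" "m - l"] assms by (simp add: tendsto_diff)

section \<open>Disjoint elements\<close>

lemma inf_diff_inf_eq_0: "inf (x - inf x y) (y - inf x y) = (0::'a::lattice_ab_group_add)"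
  by (metis add_inf_distrib_right diff_self diff_conv_add_uminus)

text \<open>Both multiples lie below multiples by \<open>m = max a b\<close>, and dividing by
  \<open>m\<close> brings their infimum back below \<open>inf x y\<close>.\<close>

lemma inf_scaleR_eq_0:
  fixes x y :: "'a::banach_lattice"
  assumes "0 \<le> x" "0 \<le> y" "inf x y = 0" "0 < a" "0 < b"
  shows "inf (a *\<^sub>R x) (b *\<^sub>R y) = 0"
proof (rule antisym)
  define m where "m = max a b"
  have m: "m > 0" "a \<le> m" "b \<le> m" using assms by (auto simp: m_def)
  let ?z = "inf (a *\<^sub>R x) (b *\<^sub>R y)"
  have "?z \<le> m *\<^sub>R x" "?z \<le> m *\<^sub>R y"
    using assms m by (meson inf_le1 inf_le2 order_trans scaleR_right_mono)+
  hence "(1/m) *\<^sub>R ?z \<le> (1/m) *\<^sub>R m *\<^sub>R x" "(1/m) *\<^sub>R ?z \<le> (1/m) *\<^sub>R m *\<^sub>R y"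
    using m by (meson less_imp_le scaleR_left_mono zero_less_divide_1_iff)+
  hence "(1/m) *\<^sub>R ?z \<le> inf x y" using m by simp
  hence "m *\<^sub>R (1/m) *\<^sub>R ?z \<le> m *\<^sub>R 0" using m assms(3) by (intro scaleR_left_mono) auto
  thus "?z \<le> 0" using m by simp
  show "0 \<le> ?z" using assms by (simp add: scaleR_nonneg_nonneg)
qed

text \<open>For disjoint positive vectors the modulus of \<open>x - y\<close> is
  \<open>x + y\<close>, which dominates \<open>x\<close>. This keeps disjoint unit vectors at
  distance at least 1.\<close>

lemma norm_le_norm_diff_disjoint:
  fixes x y :: "'a::banach_lattice"
  assumes "0 \<le> x" "0 \<le> y" "inf x y = 0"
  shows "norm x \<le> norm (x - y)"
proof (rule lattice_norm)
  have 1: "sup x (- x) = x"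
    using assms(1) by (meson minus_le_self_iff sup.absorb1)
  have "sup (x - y) (- (x - y)) = sup (x + x) (y + y) - (x + y)"
  proof -
    have "sup (x + x) (y + y) - (x + y) = sup (x + x + - (x + y)) (y + y + - (x + y))"
      unfolding diff_conv_add_uminus[of "sup _ _"] by (rule add_sup_distrib_right)
    thus ?thesis by (simp add: algebra_simps)
  qed
  also have "sup (x + x) (y + y) \<ge> (x + y) + x"
  proof -
    have "inf (x + x) (y + y) = 0"
      using inf_scaleR_eq_0[OF assms, of 2 2] by (simp add: scaleR_2)
    hence "x + x + (y + y) = sup (x + x) (y + y)" using add_eq_inf_sup[of "x+x" "y+y"] by simp
    moreover have "x + y + x \<le> x + x + (y + y)" using assms(2) by (simp add: algebra_simps)
    ultimately show ?thesis by simp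
  qed
  hence "x \<le> sup (x + x) (y + y) - (x + y)" by (simp add: algebra_simps)
  finally show "sup x (- x) \<le> sup (x - y) (- (x - y))" unfolding 1 .
qed

section \<open>Positive functionals\<close>

definition sublinear :: "('a::real_vector \<Rightarrow> real) \<Rightarrow> bool" where
  "sublinear p \<longleftrightarrow> (\<forall>x y. p (x + y) \<le> p x + p y) \<and> (\<forall>c>0. \<forall>x. p (c *\<^sub>R x) \<le> c * p x)"

lemma sublinear_add: "sublinear p \<Longrightarrow> p (x + y) \<le> p x + p y"
  and sublinear_scaleR_le: "sublinear p \<Longrightarrow> 0 < c \<Longrightarrow> p (c *\<^sub>R x) \<le> c * p x"
  by (auto simp: sublinear_def)

lemma sublinear_zero: "sublinear p \<Longrightarrow> p 0 = 0"
  using sublinear_scaleR_le[of p 2 0] sublinear_scaleR_le[of p "1/2" 0] by simp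

lemma sublinear_minus: "sublinear p \<Longrightarrow> - p (- x) \<le> p x"
  using sublinear_add[of p x "-x"] sublinear_zero[of p] by simp

text \<open>The definition demands only one inequality, for \<open>c > 0\<close>; applied to
  \<open>1 / c\<close> it gives the reverse one.\<close>

lemma sublinear_scaleR:
  assumes "sublinear p" "0 \<le> c"
  shows "p (c *\<^sub>R x) = c * p x"
proof (cases "c = 0")
  case False
  hence c: "c > 0" using assms by simp
  have "p ((1/c) *\<^sub>R c *\<^sub>R x) \<le> (1/c) * p (c *\<^sub>R x)"
    using assms c by (intro sublinear_scaleR_le) auto
  hence "c * p x \<le> p (c *\<^sub>R x)" using c by (simp add: field_simps)
  thus ?thesis using sublinear_scaleR_le[OF assms(1) c, of x] by simp
qed (simp add: sublinear_zero[OF assms(1)])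

text \<open>The Hahn-Banach step in the single direction \<open>y\<close>: the last bound at
  \<open>x = - y\<close> gives \<open>q (- y) \<le> - p y\<close>, so a linear functional below
  \<open>q\<close> must attain \<open>p y\<close> at \<open>y\<close>.\<close>

lemma sublinear_tilt:
  assumes p: "sublinear p"
  obtains q where "sublinear q" "\<And>x. q x \<le> p x" "\<And>x. q x \<le> p (x + y) - p y"
proof -
  define q where "q x = (INF t\<in>{0..}. p (x + t *\<^sub>R y) - t * p y)" for x
  \<comment> \<open>Subadditivity applied to
    \<open>t *\<^sub>R y = (x + t *\<^sub>R y) + (- x)\<close>; it makes the infimum finite.\<close>
  have lb: "- p (- x) \<le> p (x + t *\<^sub>R y) - t * p y" if "t \<ge> 0" for x t
    using sublinear_add[OF p, of "x + t *\<^sub>R y" "- x"] sublinear_scaleR[OF p that, of y] by simp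
  have bdd: "bdd_below ((\<lambda>t. p (x + t *\<^sub>R y) - t * p y) ` {0..})" for x
    by (rule bdd_belowI2[of _ "- p (- x)"]) (use lb in auto)
  have le: "q x \<le> p (x + t *\<^sub>R y) - t * p y" if "t \<ge> 0" for x t
    unfolding q_def using bdd that by (intro cINF_lower) auto
  have ge: "c \<le> q x" if "\<And>t. t \<ge> 0 \<Longrightarrow> c \<le> p (x + t *\<^sub>R y) - t * p y" for c x
    unfolding q_def using that by (intro cINF_greatest) auto
  have "sublinear q"
    unfolding sublinear_def
  proof safe
    fix x z
    have "q (x + z) \<le> (p (x + t *\<^sub>R y) - t * p y) + (p (z + s *\<^sub>R y) - s * p y)"
      if "t \<ge> 0" "s \<ge> 0" for t s
    proof -
      have "q (x + z) \<le> p ((x + z) + (t + s) *\<^sub>R y) - (t + s) * p y" using that by (intro le) simp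
      also have "(x + z) + (t + s) *\<^sub>R y = (x + t *\<^sub>R y) + (z + s *\<^sub>R y)" by (simp add: algebra_simps)
      finally show ?thesis using sublinear_add[OF p, of "x + t *\<^sub>R y" "z + s *\<^sub>R y"]
        by (simp add: algebra_simps)
    qed
    hence "q (x + z) - (p (z + s *\<^sub>R y) - s * p y) \<le> q x" if "s \<ge> 0" for s
      using that by (intro ge) (simp add: algebra_simps)
    hence "q (x + z) - q x \<le> q z" by (intro ge) (simp add: algebra_simps)
    thus "q (x + z) \<le> q x + q z" by simp
  next
    fix c :: real and x assume c: "c > 0"
    have "(1/c) * q (c *\<^sub>R x) \<le> q x"
    proof (rule ge)
      fix t :: real assume t: "t \<ge> 0"
      have "q (c *\<^sub>R x) \<le> p (c *\<^sub>R x + (c * t) *\<^sub>R y) - (c * t) * p y" using t c by (intro le) simp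
      also have "c *\<^sub>R x + (c * t) *\<^sub>R y = c *\<^sub>R (x + t *\<^sub>R y)" by (simp add: algebra_simps)
      finally have "q (c *\<^sub>R x) \<le> c * (p (x + t *\<^sub>R y) - t * p y)"
        using sublinear_scaleR[OF p, of c "x + t *\<^sub>R y"] c by (simp add: algebra_simps)
      thus "(1/c) * q (c *\<^sub>R x) \<le> p (x + t *\<^sub>R y) - t * p y" using c by (simp add: field_simps)
    qed
    thus "q (c *\<^sub>R x) \<le> c * q x" using c by (simp add: field_simps)
  qed
  moreover have "q x \<le> p x" for x using le[of 0 x] by simp
  moreover have "q x \<le> p (x + y) - p y" for x using le[of 1 x] by simp
  ultimately show ?thesis using that by blast
qed

text \<open>Supplies the lower bounds for Zorn's lemma. The common majorant \<open>p\<close> keeps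
  the infimum finite, and for subadditivity the smaller of two members of the chain replaces
  both.\<close>

lemma sublinear_INF_chain:
  assumes C: "C \<noteq> {}" "\<And>q. q \<in> C \<Longrightarrow> sublinear q \<and> (\<forall>x. q x \<le> p x)"
    and chain: "\<And>q r. q \<in> C \<Longrightarrow> r \<in> C \<Longrightarrow> (\<forall>x. q x \<le> r x) \<or> (\<forall>x. r x \<le> q x)"
  obtains u where "sublinear u" "\<And>q x. q \<in> C \<Longrightarrow> u x \<le> q x"
proof -
  define u where "u x = (INF q\<in>C. q x)" for x
  have bdd: "bdd_below ((\<lambda>q. q x) ` C)" for x
  proof (rule bdd_belowI2)
    fix q assume "q \<in> C"
    thus "- p (- x) \<le> q x" using C(2)[of q] sublinear_minus[of q x]
      by (meson le_imp_neg_le order_trans)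
  qed
  have le: "u x \<le> q x" if "q \<in> C" for q x
    unfolding u_def using bdd that by (intro cINF_lower) auto
  have ge: "c \<le> u x" if "\<And>q. q \<in> C \<Longrightarrow> c \<le> q x" for c x
    unfolding u_def using that C by (intro cINF_greatest) auto
  have "sublinear u"
    unfolding sublinear_def
  proof safe
    fix x z
    have *: "u (x + z) \<le> q x + r z" if "q \<in> C" "r \<in> C" for q r
    proof -
      from chain[OF that] show ?thesis
      proof
        assume "\<forall>x. q x \<le> r x"
        moreover have "u (x + z) \<le> q x + q z"
          using le[OF that(1), of "x + z"] sublinear_add[of q x z] C(2)[OF that(1)] by linarith
        ultimately show ?thesis by (meson add_left_mono order_trans)
      next
        assume "\<forall>x. r x \<le> q x"
        moreover have "u (x + z) \<le> r x + r z"
          using le[OF that(2), of "x + z"] sublinear_add[of r x z] C(2)[OF that(2)] by linarith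
        ultimately show ?thesis by (meson add_right_mono order_trans)
      qed
    qed
    have "u (x + z) - r z \<le> u x" if "r \<in> C" for r
      using *[OF _ that] by (intro ge) (simp add: algebra_simps)
    hence "u (x + z) - u x \<le> u z" by (intro ge) (simp add: algebra_simps)
    thus "u (x + z) \<le> u x + u z" by simp
  next
    fix c :: real and x assume c: "c > 0"
    have "(1/c) * u (c *\<^sub>R x) \<le> u x"
    proof (rule ge)
      fix q assume q: "q \<in> C"
      have "u (c *\<^sub>R x) \<le> c * q x"
        using le[OF q, of "c *\<^sub>R x"] sublinear_scaleR_le[of q c x] C(2)[OF q] c by linarith
      thus "(1/c) * u (c *\<^sub>R x) \<le> q x" using c by (simp add: field_simps)
    qed
    thus "u (c *\<^sub>R x) \<le> c * u x" using c by (simp add: field_simps)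
  qed
  thus ?thesis using that le by blast
qed

text \<open>A pointwise minimal sublinear functional below \<open>p\<close> coincides with all its tilts, which makes it additive.\<close>

lemma sublinear_dominates_linear:
  assumes p: "sublinear p"
  obtains f where "linear f" "\<And>x. f x \<le> p x"
proof -
  define A where "A = {q. sublinear q \<and> (\<forall>x. q x \<le> p x)}"
  \<comment> \<open>The order is reversed, so that the maximal element from Zorn's lemma is
    pointwise minimal.\<close>
  define ge where "ge q r \<longleftrightarrow> (\<forall>x. r x \<le> q x)" for q r :: "'a \<Rightarrow> real"
  have po: "partial_order_on A (relation_of ge A)"
  proof (rule partial_order_on_relation_ofI)
    show "\<And>a b. a \<in> A \<Longrightarrow> b \<in> A \<Longrightarrow> ge a b \<Longrightarrow> ge b a \<Longrightarrow> a = b"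
      unfolding ge_def by (meson antisym ext)
  qed (auto simp: ge_def intro: order_trans)
  have "\<exists>m\<in>A. \<forall>a\<in>A. ge m a \<longrightarrow> a = m"
  proof (rule predicate_Zorn[OF po])
    fix C assume C: "C \<in> Chains (relation_of ge A)"
    have CA: "C \<subseteq> A" using C by (auto simp: Chains_def relation_of_def)
    have ch: "ge q r \<or> ge r q" if "q \<in> C" "r \<in> C" for q r
      using C that by (auto simp: Chains_def relation_of_def)
    show "\<exists>u\<in>A. \<forall>a\<in>C. ge a u"
    proof (cases "C = {}")
      case True
      have "p \<in> A" using p by (simp add: A_def)
      thus ?thesis using True by auto
    next
      case False
      then obtain u where u: "sublinear u" "\<And>q x. q \<in> C \<Longrightarrow> u x \<le> q x"
        using CA ch by (rule_tac sublinear_INF_chain[of C p]) (auto simp: A_def ge_def)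
      obtain q where "q \<in> C" using False by auto
      hence "u x \<le> p x" for x using u(2)[of q x] CA unfolding A_def by (auto intro: order_trans)
      hence "u \<in> A" using u(1) by (simp add: A_def)
      thus ?thesis using u(2) by (auto simp: ge_def)
    qed
  qed
  then obtain f where f: "f \<in> A" and min: "\<And>q. q \<in> A \<Longrightarrow> (\<And>x. q x \<le> f x) \<Longrightarrow> q = f"
    unfolding ge_def by blast
  have sf: "sublinear f" and fp: "\<And>x. f x \<le> p x" using f by (auto simp: A_def)
  have add: "f (x + y) = f x + f y" for x y
  proof -
    obtain q where q: "sublinear q" "\<And>x. q x \<le> f x" "\<And>x. q x \<le> f (x + y) - f y"
      using sublinear_tilt[OF sf] by metis
    have "q \<in> A" using q fp by (auto simp: A_def intro: order_trans)
    hence "q = f" using q min by blast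
    thus ?thesis using q(3)[of x] sublinear_add[OF sf, of x y] by simp
  qed
  have neg: "f (- x) = - f x" for x using add[of x "-x"] sublinear_zero[OF sf] by simp
  have "f (c *\<^sub>R x) = c * f x" for c x
  proof (cases "c \<ge> 0")
    case False
    hence "f ((- c) *\<^sub>R x) = (- c) * f x" by (intro sublinear_scaleR[OF sf]) simp
    thus ?thesis using neg[of "c *\<^sub>R x"] by simp
  qed (simp add: sublinear_scaleR[OF sf])
  hence "linear f" using add by (intro linearI) auto
  thus ?thesis using fp that by blast
qed

text \<open>Tilting along \<open>v\<close> before applying Hahn-Banach forces
  \<open>f (- v) \<le> - p v\<close>, the missing half of the equality at \<open>v\<close>.\<close>

lemma sublinear_supporting_linear:
  assumes p: "sublinear p"
  obtains f where "linear f" "\<And>x. f x \<le> p x" "f v = p v"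
proof -
  obtain q where q: "sublinear q" "\<And>x. q x \<le> p x" "\<And>x. q x \<le> p (x + v) - p v"
    using sublinear_tilt[OF p] by metis
  obtain f where f: "linear f" "\<And>x. f x \<le> q x"
    using sublinear_dominates_linear[OF q(1)] by blast
  have "f (- v) \<le> - p v" using f(2)[of "- v"] q(3)[of "- v"] sublinear_zero[OF p] by simp
  hence "f v \<ge> p v" using linear_neg[OF f(1), of v] by simp
  moreover have "f x \<le> p x" for x using f(2) q(2) order_trans by blast
  ultimately show ?thesis using that f(1) by (metis antisym)
qed

section \<open>Separation by positive functionals\<close>

lemma norm_pprt_diff_antimono:
  fixes u x :: "'a::banach_lattice"
  assumes "0 \<le> u" "a \<le> b"
  shows "norm (pprt (x - b *\<^sub>R u)) \<le> norm (pprt (x - a *\<^sub>R u))"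
proof (rule norm_mono_nonneg)
  show "pprt (x - b *\<^sub>R u) \<le> pprt (x - a *\<^sub>R u)"
    using scaleR_right_mono[OF assms(2,1)] by (intro pprt_mono) simp
qed simp

text \<open>The functional is obtained from \<open>p x = inf\<^sub>t \<parallel>(x - t u)\<^sup>+\<parallel>\<close>, which vanishes at \<open>u\<close>
  and on the negative cone, so that every linear minorant of \<open>p\<close> is positive and annihilates \<open>u\<close>.\<close>

lemma positive_functional_separating:
  fixes u v :: "'a::banach_lattice"
  assumes u: "0 \<le> u" and v: "0 \<le> v"
    and nlim: "\<not> (\<lambda>n. inf v (real n *\<^sub>R u)) \<longlonglongrightarrow> v"
  obtains \<phi> where "positive_functional \<phi>" "\<phi> u = 0" "0 < \<phi> v"
proof -
  define p where "p x = (INF t\<in>{0..}. norm (pprt (x - t *\<^sub>R u)))" for x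
  have bdd: "bdd_below ((\<lambda>t. norm (pprt (x - t *\<^sub>R u))) ` {0..})" for x
    by (rule bdd_belowI2[of _ 0]) auto
  have le: "p x \<le> norm (pprt (x - t *\<^sub>R u))" if "t \<ge> 0" for x t
    unfolding p_def using bdd that by (intro cINF_lower) auto
  have ge: "c \<le> p x" if "\<And>t. t \<ge> 0 \<Longrightarrow> c \<le> norm (pprt (x - t *\<^sub>R u))" for c x
    unfolding p_def using that by (intro cINF_greatest) auto
  have sub: "sublinear p"
    unfolding sublinear_def
  proof safe
    fix x y
    have *: "p (x + y) \<le> norm (pprt (x - t *\<^sub>R u)) + norm (pprt (y - s *\<^sub>R u))"
      if "t \<ge> 0" "s \<ge> 0" for t s
    proof -
      have "p (x + y) \<le> norm (pprt (x + y - (t + s) *\<^sub>R u))" using that by (intro le) simp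
      also have "\<dots> \<le> norm (pprt (x - t *\<^sub>R u) + pprt (y - s *\<^sub>R u))"
      proof (rule norm_mono_nonneg)
        have "x - t *\<^sub>R u + (y - s *\<^sub>R u) \<le> pprt (x - t *\<^sub>R u) + pprt (y - s *\<^sub>R u)"
          unfolding pprt_def by (intro add_mono) auto
        moreover have "0 \<le> pprt (x - t *\<^sub>R u) + pprt (y - s *\<^sub>R u)" by simp
        ultimately show "pprt (x + y - (t + s) *\<^sub>R u) \<le> pprt (x - t *\<^sub>R u) + pprt (y - s *\<^sub>R u)"
          unfolding pprt_def[of "x + y - _"] by (simp add: algebra_simps)
      qed simp
      also have "\<dots> \<le> norm (pprt (x - t *\<^sub>R u)) + norm (pprt (y - s *\<^sub>R u))" by (rule norm_triangle_ineq)
      finally show ?thesis .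
    qed
    have "p (x + y) - norm (pprt (y - s *\<^sub>R u)) \<le> p x" if "s \<ge> 0" for s
      using *[OF _ that] by (intro ge) (simp add: algebra_simps)
    hence "p (x + y) - p x \<le> p y" by (intro ge) (simp add: algebra_simps)
    thus "p (x + y) \<le> p x + p y" by simp
  next
    fix c :: real and x assume c: "c > 0"
    have "(1/c) * p (c *\<^sub>R x) \<le> p x"
    proof (rule ge)
      fix t :: real assume t: "t \<ge> 0"
      have "p (c *\<^sub>R x) \<le> norm (pprt (c *\<^sub>R x - (c * t) *\<^sub>R u))" using t c by (intro le) simp
      also have "\<dots> \<le> norm (c *\<^sub>R pprt (x - t *\<^sub>R u))"
      proof (rule norm_mono_nonneg)
        have "c *\<^sub>R (x - t *\<^sub>R u) \<le> c *\<^sub>R pprt (x - t *\<^sub>R u)"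
          unfolding pprt_def using c by (intro scaleR_left_mono) auto
        moreover have "0 \<le> c *\<^sub>R pprt (x - t *\<^sub>R u)" using c by (simp add: scaleR_nonneg_nonneg)
        ultimately show "pprt (c *\<^sub>R x - (c * t) *\<^sub>R u) \<le> c *\<^sub>R pprt (x - t *\<^sub>R u)"
          unfolding pprt_def[of "c *\<^sub>R x - _"] by (simp add: algebra_simps)
      qed simp
      finally show "(1/c) * p (c *\<^sub>R x) \<le> norm (pprt (x - t *\<^sub>R u))" using c by (simp add: field_simps)
    qed
    thus "p (c *\<^sub>R x) \<le> c * p x" using c by (simp add: field_simps)
  qed
  have pnorm: "p x \<le> norm x" for x
    using le[of 0 x] norm_pprt_le[of x] by simp
  have pneg: "p x \<le> 0" if "x \<le> 0" for x
    using le[of 0 x] that by simp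
  have pu: "p u \<le> 0" using le[of 1 u] by simp
  have pv: "p v > 0"
  proof -
    \<comment> \<open>\<open>v - inf v (t *\<^sub>R u)\<close> is the positive part of
      \<open>v - t *\<^sub>R u\<close>, so \<open>nlim\<close> says that the norms of these parts do
      not tend to 0 along the integers.\<close>
    have eq: "inf v (t *\<^sub>R u) - v = - pprt (v - t *\<^sub>R u)" for t
      using add_inf_distrib_left[of v 0 "t *\<^sub>R u - v"]
      unfolding pprt_def neg_sup_eq_inf by (simp add: inf_commute algebra_simps)
    obtain e where e: "e > 0" "\<And>N. \<exists>n\<ge>N. \<not> norm (inf v (real n *\<^sub>R u) - v) < e"
      using nlim unfolding LIMSEQ_iff by blast
    \<comment> \<open>These norms decrease in \<open>t\<close> and are at least \<open>e\<close> at
      arbitrarily large integers, hence at every \<open>t \<ge> 0\<close>.\<close>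
    have "e \<le> p v"
    proof (rule ge)
      fix t :: real assume "t \<ge> 0"
      obtain n where n: "n \<ge> nat \<lceil>t\<rceil>" "\<not> norm (inf v (real n *\<^sub>R u) - v) < e" using e(2) by blast
      have "t \<le> real n" using n(1) by linarith
      thus "e \<le> norm (pprt (v - t *\<^sub>R u))"
        using n(2) norm_pprt_diff_antimono[OF u, of t "real n" v] unfolding eq by simp
    qed
    thus ?thesis using e(1) by simp
  qed
  obtain f where f: "linear f" "\<And>x. f x \<le> p x" "f v = p v"
    using sublinear_supporting_linear[OF sub] by blast
  have bl: "bounded_linear f"
  proof -
    have "\<bar>f x\<bar> \<le> 1 * norm x" for x
      using f(2)[of x] f(2)[of "- x"] pnorm[of x] pnorm[of "- x"] linear_neg[OF f(1), of x] by simp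
    thus ?thesis using f(1) by (intro bounded_linear.intro bounded_linear_axioms.intro)
        (auto intro!: exI[of _ 1])
  qed
  have pos: "0 \<le> f x" if "0 \<le> x" for x
    using f(2)[of "- x"] pneg[of "- x"] that linear_neg[OF f(1), of x] by simp
  have app: "blinfun_apply (Blinfun f) = f" using bl by (rule bounded_linear_Blinfun_apply)
  show ?thesis
  proof (rule that[of "Blinfun f"])
    show "positive_functional (Blinfun f)" unfolding positive_functional_def app using pos by blast
    show "blinfun_apply (Blinfun f) u = 0" unfolding app using f(2)[of u] pu pos[OF u] by simp
    show "0 < blinfun_apply (Blinfun f) v" unfolding app using f(3) pv by simp
  qed
qed

text \<open>Separation with \<open>u = 0\<close>: the constant sequence \<open>inf v 0 = 0\<close>
  cannot tend to \<open>v\<close>.\<close>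

lemma positive_functional_exists:
  fixes v :: "'a::banach_lattice"
  assumes "0 \<le> v" "v \<noteq> 0"
  obtains \<psi> where "positive_functional \<psi>" "0 < \<psi> v"
proof (rule positive_functional_separating[of 0 v])
  show "\<not> (\<lambda>n. inf v (real n *\<^sub>R 0)) \<longlonglongrightarrow> v"
    using assms by (simp add: inf.absorb2 LIMSEQ_const_iff)
qed (use assms that in auto)

section \<open>Relative compactness in operator norm\<close>

text \<open>An \<open>e / 2\<close>-net of a set approximating \<open>X\<close> up to
  \<open>e / 2\<close> is an \<open>e\<close>-net of \<open>X\<close>.\<close>

lemma totally_bounded_approx:
  fixes X :: "'a::metric_space set"
  assumes "\<And>e. e > 0 \<Longrightarrow> \<exists>Y. totally_bounded Y \<and> (\<forall>x\<in>X. \<exists>y\<in>Y. dist x y < e)"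
  shows "totally_bounded X"
  unfolding totally_bounded_metric
proof safe
  fix e :: real assume "e > 0"
  hence e: "e / 2 > 0" by simp
  obtain Y where Y: "totally_bounded Y" "\<And>x. x \<in> X \<Longrightarrow> \<exists>y\<in>Y. dist x y < e / 2"
    using assms[OF e] by blast
  obtain k where k: "finite k" "Y \<subseteq> (\<Union>x\<in>k. {y. dist x y < e / 2})"
    using Y(1) e unfolding totally_bounded_metric by blast
  have "X \<subseteq> (\<Union>x\<in>k. {y. dist x y < e})"
  proof
    fix x assume "x \<in> X"
    then obtain y where y: "y \<in> Y" "dist x y < e / 2" using Y(2) by blast
    then obtain c where "c \<in> k" "dist c y < e / 2" using k(2) by blast
    thus "x \<in> (\<Union>x\<in>k. {y. dist x y < e})" using y dist_triangle_half_l[of c y e x]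
      by (auto simp: dist_commute)
  qed
  thus "\<exists>k. finite k \<and> X \<subseteq> (\<Union>x\<in>k. {y. dist x y < e})" using k(1) by blast
qed

lemma compact_imp_totally_bounded_metric:
  fixes X :: "'a::metric_space set"
  shows "compact X \<Longrightarrow> totally_bounded X"
  unfolding totally_bounded_metric compact_eq_totally_bounded ball_def by blast

lemma totally_bounded_finite_net:
  fixes X :: "'a::metric_space set"
  assumes "totally_bounded X" "e > 0"
  obtains k where "finite k" "\<And>x. x \<in> X \<Longrightarrow> \<exists>c\<in>k. dist c x < e"
  using assms unfolding totally_bounded_metric by (force simp: subset_eq)

lemma totally_bounded_convergent_subseq:
  fixes f :: "nat \<Rightarrow> 'a::complete_space"
  assumes "totally_bounded (range f)"
  obtains l r where "strict_mono r" "(f \<circ> r) \<longlonglongrightarrow> l"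
proof -
  have "\<exists>k. finite k \<and> closure (range f) \<subseteq> (\<Union>x\<in>k. ball x e)" if "e > 0" for e
  proof -
    have "e / 2 > 0" using that by simp
    from totally_bounded_finite_net[OF assms this]
    obtain k where k: "finite k" "\<And>y. y \<in> range f \<Longrightarrow> \<exists>c\<in>k. dist c y < e / 2"
      by metis
    \<comment> \<open>Closed balls, since a finite union of them is closed and so also covers the
      closure.\<close>
    have "range f \<subseteq> (\<Union>x\<in>k. cball x (e / 2))"
    proof
      fix y assume "y \<in> range f"
      then obtain c where "c \<in> k" "dist c y < e / 2" using k(2) by blast
      thus "y \<in> (\<Union>x\<in>k. cball x (e / 2))" by (auto intro: less_imp_le)
    qed
    moreover have "closed (\<Union>x\<in>k. cball x (e / 2))" using k(1) by blast
    ultimately have "closure (range f) \<subseteq> (\<Union>x\<in>k. cball x (e / 2))" by (simp add: closure_minimal)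
    also have "\<dots> \<subseteq> (\<Union>x\<in>k. ball x e)"
      using that by (intro UN_mono order_refl) auto
    finally show ?thesis using k(1) by blast
  qed
  hence "compact (closure (range f))"
    unfolding compact_eq_totally_bounded by (auto simp: complete_eq_closed)
  moreover have "\<forall>n. f n \<in> closure (range f)" using closure_subset[of "range f"] by auto
  ultimately show ?thesis using that unfolding compact_def by meson
qed

lemma compact_operator_totally_bounded_ball:
  assumes "compact_operator K"
  shows "totally_bounded (blinfun_apply K ` ball 0 \<rho>)"
proof (cases "\<rho> > 0")
  case True
  have "compact ((\<lambda>x. \<rho> *\<^sub>R x) ` closure (blinfun_apply K ` ball 0 1))"
    using assms unfolding compact_operator_def by (rule compact_scaling)
  moreover have "blinfun_apply K ` ball 0 \<rho> \<subseteq> (\<lambda>x. \<rho> *\<^sub>R x) ` closure (blinfun_apply K ` ball 0 1)"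
  proof
    fix y assume "y \<in> blinfun_apply K ` ball 0 \<rho>"
    then obtain x where x: "norm x < \<rho>" "y = K x" by auto
    have "norm ((1/\<rho>) *\<^sub>R x) < 1" using x True by simp
    hence "K ((1/\<rho>) *\<^sub>R x) \<in> closure (blinfun_apply K ` ball 0 1)"
      using closure_subset[of "blinfun_apply K ` ball 0 1"] by auto
    moreover have "y = \<rho> *\<^sub>R K ((1/\<rho>) *\<^sub>R x)" using x True by (simp add: blinfun.scaleR_right)
    ultimately show "y \<in> (\<lambda>x. \<rho> *\<^sub>R x) ` closure (blinfun_apply K ` ball 0 1)" by blast
  qed
  ultimately show ?thesis using compact_imp_totally_bounded_metric totally_bounded_subset by blast
next
  case False
  thus ?thesis by (simp add: ball_empty)
qed

lemma compact_operator_0: "compact_operator 0"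
  unfolding compact_operator_def by (simp add: zero_blinfun.rep_eq image_constant_conv)

lemma ess_norm_less_compact_approx:
  assumes "ess_norm R < e"
  obtains K where "compact_operator K" "norm (R - K) < e"
proof -
  have "{norm (R - K) | K. compact_operator K} \<noteq> {}" using compact_operator_0 by blast
  from cInf_lessD[OF this assms[unfolded ess_norm_def]] show ?thesis using that by blast
qed

lemma asymptotically_compact_approx:
  assumes "asymptotically_compact S" "e > 0"
  obtains s K where "s > b" "compact_operator K" "norm (S s - K) < e"
proof -
  have "eventually (\<lambda>t. dist (ess_norm (S t)) 0 < e) at_top"
    using assms unfolding asymptotically_compact_def by (rule tendstoD)
  moreover have "eventually (\<lambda>t::real. t > b) at_top" by (rule eventually_gt_at_top)
  ultimately have "eventually (\<lambda>t. dist (ess_norm (S t)) 0 < e \<and> t > b) at_top"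
    by (rule eventually_conj)
  then obtain s where "dist (ess_norm (S s)) 0 < e" "s > b"
    unfolding eventually_at_top_linorder by blast
  hence "ess_norm (S s) < e" "s > b" by (auto simp: dist_real_def)
  thus ?thesis using ess_norm_less_compact_approx that by blast
qed

lemma totally_bounded_finite: "finite X \<Longrightarrow> totally_bounded (X :: 'a::metric_space set)"
  by (simp add: compact_imp_totally_bounded_metric finite_imp_compact)

text \<open>If \<open>S s\<close> is within \<open>e / \<rho>\<close> of a compact \<open>K\<close>,
  the tail of the sequence is within \<open>e\<close> of the image of the ball under
  \<open>K\<close>; the finitely many earlier terms are added to that image.\<close>

lemma totally_bounded_in_semigroup_images:
  fixes x :: "nat \<Rightarrow> 'a::real_normed_vector"
  assumes S: "asymptotically_compact S"
    and x: "\<And>s. s > 0 \<Longrightarrow> eventually (\<lambda>n. x n \<in> blinfun_apply (S s) ` ball 0 \<rho>) sequentially"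
    and \<rho>: "\<rho> > 0"
  shows "totally_bounded (range x)"
proof (rule totally_bounded_approx)
  fix e :: real assume e: "e > 0"
  obtain s K where s: "s > 0" "compact_operator K" "norm (S s - K) < e / \<rho>"
    using asymptotically_compact_approx[OF S, of "e / \<rho>" 0] e \<rho> by auto
  obtain N where N: "\<And>n. n \<ge> N \<Longrightarrow> x n \<in> blinfun_apply (S s) ` ball 0 \<rho>"
    using x[OF s(1)] unfolding eventually_sequentially by blast
  let ?Y = "\<Union>{blinfun_apply K ` ball 0 \<rho>, x ` {..<N}}"
  have "totally_bounded ?Y"
    using s(2) compact_operator_totally_bounded_ball totally_bounded_finite[of "x ` {..<N}"]
    by (intro totally_bounded_Union) auto
  moreover have "\<exists>y\<in>?Y. dist (x n) y < e" for n
  proof (cases "n < N")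
    case True thus ?thesis using e by (intro bexI[of _ "x n"]) auto
  next
    case False
    then obtain z where z: "norm z < \<rho>" "x n = S s z" using N[of n] by auto
    have "dist (x n) (K z) = norm ((S s - K) z)" using z by (simp add: dist_norm blinfun.diff_left)
    also have "\<dots> \<le> norm (S s - K) * norm z" by (rule norm_blinfun)
    also have "\<dots> \<le> norm (S s - K) * \<rho>" using z by (intro mult_left_mono) auto
    also have "\<dots> < e" using s(3) \<rho> by (simp add: field_simps)
    finally show ?thesis using z by (intro bexI[of _ "K z"]) auto
  qed
  ultimately show "\<exists>Y. totally_bounded Y \<and> (\<forall>x\<in>range x. \<exists>y\<in>Y. dist x y < e)" by blast
qed

text \<open>Label every index by a choice of nearby centres, one for each \<open>y\<close>. The
  labels lie in the finite product \<open>PiE Y k\<close>, and one index per label suffices.\<close>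

lemma simultaneous_finite_net:
  fixes D :: "'i \<Rightarrow> 'y \<Rightarrow> 'b::metric_space"
  assumes "finite Y" "\<And>y. y \<in> Y \<Longrightarrow> totally_bounded (range (\<lambda>i. D i y))" "e > 0"
  obtains M where "finite M" "\<And>i. \<exists>m\<in>M. \<forall>y\<in>Y. dist (D i y) (D m y) < e"
proof -
  have "\<forall>y\<in>Y. \<exists>k. finite k \<and> (\<forall>i. \<exists>c\<in>k. dist c (D i y) < e / 2)"
  proof
    fix y assume "y \<in> Y"
    thus "\<exists>k. finite k \<and> (\<forall>i. \<exists>c\<in>k. dist c (D i y) < e / 2)"
      using totally_bounded_finite_net[OF assms(2), of y "e / 2"] assms(3) by (metis half_gt_zero rangeI)
  qed
  then obtain k where k: "\<And>y. y \<in> Y \<Longrightarrow> finite (k y)"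
     "\<And>y i. y \<in> Y \<Longrightarrow> \<exists>c\<in>k y. dist c (D i y) < e / 2"
    unfolding bchoice_iff by blast
  define f where "f i = (\<lambda>y\<in>Y. SOME c. c \<in> k y \<and> dist c (D i y) < e / 2)" for i
  have f: "f i y \<in> k y" "dist (f i y) (D i y) < e / 2" if "y \<in> Y" for i y
    using someI_ex[of "\<lambda>c. c \<in> k y \<and> dist c (D i y) < e / 2"] k(2)[OF that, of i] that
    unfolding f_def by auto
  have "range f \<subseteq> PiE Y k" using f(1) by (auto simp: f_def PiE_def extensional_def)
  moreover have "finite (PiE Y k)" using assms(1) k(1) by (rule finite_PiE)
  ultimately have fin: "finite (range f)" by (rule finite_subset)
  define M where "M = (\<lambda>g. SOME i. f i = g) ` range f"
  show ?thesis
  proof (rule that[of M])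
    show "finite M" using fin by (simp add: M_def)
    fix i
    define m where "m = (SOME j. f j = f i)"
    have "f m = f i" unfolding m_def by (rule someI[of _ i]) simp
    hence "dist (D i y) (D m y) < e" if "y \<in> Y" for y
      using f(2)[OF that, of i] f(2)[OF that, of m] dist_triangle_half_r[of "f i y" "D i y" e] by simp
    moreover have "m \<in> M" by (auto simp: M_def m_def)
    ultimately show "\<exists>m\<in>M. \<forall>y\<in>Y. dist (D i y) (D m y) < e" by blast
  qed
qed

lemma op_semigroup_apply:
  assumes "op_semigroup S" "s > 0" "t > 0"
  shows "S (s + t) x = S s (S t x)"
  using assms unfolding op_semigroup_def by (metis add.commute blinfun_apply_blinfun_compose)

text \<open>Writing \<open>S (t n) = S (t n - r) S r\<close> with \<open>S r\<close> nearly compact reduces norm convergence to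
  convergence of \<open>S (t n - r)\<close> on a finite net; writing \<open>S (t n - r) = S s S (t n - r - s)\<close> with
  \<open>S s\<close> nearly compact yields the latter.\<close>

lemma semigroup_convergent_subseq:
  fixes S :: "real \<Rightarrow> ('a::banach \<Rightarrow>\<^sub>L 'a)"
  assumes S: "op_semigroup S" "asymptotically_compact S"
    and t: "filterlim t at_top sequentially"
    and c: "\<And>n. c n > 0"
    and C: "\<And>r. r > 0 \<Longrightarrow> eventually (\<lambda>n. norm (S (t n - r)) \<le> C * c n) sequentially" "C > 0"
  obtains R k where "strict_mono k" "(\<lambda>n. (1 / c (k n)) *\<^sub>R S (t (k n))) \<longlonglongrightarrow> R"
proof -
  define A where "A n = (1 / c n) *\<^sub>R S (t n)" for n
  define D where "D r n = (1 / c n) *\<^sub>R S (t n - r)" for r n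
  have Dnorm: "eventually (\<lambda>n. norm (D r n) \<le> C) sequentially" if "r > 0" for r
    using C(1)[OF that]
  proof eventually_elim
    case (elim n)
    thus ?case using c[of n] by (simp add: D_def field_simps)
  qed
  have tgt: "eventually (\<lambda>n. t n > b) sequentially" for b
    using t by (simp add: filterlim_at_top_dense)
  have ADr: "eventually (\<lambda>n. D r n = D (r + s) n o\<^sub>L S s \<and> D r n = S s o\<^sub>L D (r + s) n) sequentially"
    if "s > 0" for r s
  proof -
    have "eventually (\<lambda>n. t n > r + s) sequentially" by (rule tgt)
    thus ?thesis
    proof eventually_elim
      fix n assume n: "t n > r + s"
      have "S (t n - r) x = S s (S (t n - (r + s)) x)" "S (t n - r) x = S (t n - (r + s)) (S s x)" for x
        using op_semigroup_apply[OF S(1), of s "t n - (r + s)" x]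
              op_semigroup_apply[OF S(1), of "t n - (r + s)" s x] n that by (simp_all add: algebra_simps)
      thus "D r n = D (r + s) n o\<^sub>L S s \<and> D r n = S s o\<^sub>L D (r + s) n"
        by (auto intro!: blinfun_eqI simp: D_def blinfun.scaleR_left blinfun.scaleR_right)
    qed
  qed
  have tbD: "totally_bounded (range (\<lambda>n. D r n y))" if r: "r > 0" for r y
  proof (rule totally_bounded_in_semigroup_images[OF S(2)])
    show "C * norm y + 1 > 0" using C(2) by (simp add: add_nonneg_pos)
    fix s :: real assume s: "s > 0"
    have "eventually (\<lambda>n. norm (D (r + s) n) \<le> C) sequentially" using Dnorm[of "r + s"] r s by simp
    with ADr[OF s, of r] show "eventually (\<lambda>n. D r n y \<in> blinfun_apply (S s) ` ball 0 (C * norm y + 1)) sequentially"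
    proof eventually_elim
      case (elim n)
      have "norm (D (r + s) n y) \<le> C * norm y"
        using norm_blinfun[of "D (r + s) n" y] elim(2) by (meson mult_right_mono norm_ge_zero order_trans)
      moreover have "D r n y = S s (D (r + s) n y)" using elim(1) by (metis blinfun_apply_blinfun_compose)
      ultimately show ?case by (intro image_eqI[of _ _ "D (r + s) n y"]) auto
    qed
  qed
  have "totally_bounded (range A)"
    unfolding totally_bounded_metric
  proof safe
    fix e :: real assume e: "e > 0"
    \<comment> \<open>Chosen such that \<open>(4 * C + 1) * d < e\<close>: two errors of size
      \<open>2 * C * d\<close> and one of size \<open>d\<close> will occur.\<close>
    define d where "d = e / (4 * C + 2)"
    have d: "d > 0" using e C(2) by (simp add: d_def)
    obtain r K where r: "r > 0" "compact_operator K" "norm (S r - K) < d"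
      using asymptotically_compact_approx[OF S(2) d, of 0] by auto
    \<comment> \<open>Radius 2 puts all unit vectors into the open ball.\<close>
    obtain Y where Y: "finite Y" "\<And>z. z \<in> blinfun_apply K ` ball 0 2 \<Longrightarrow> \<exists>y\<in>Y. dist y z < d"
      using totally_bounded_finite_net[OF compact_operator_totally_bounded_ball[OF r(2), of 2] d] by blast
    have "eventually (\<lambda>n. norm (D r n) \<le> C \<and> A n = D r n o\<^sub>L S r) sequentially"
      using Dnorm[OF r(1)] ADr[OF r(1), of 0]
    proof eventually_elim
      case (elim n)
      have "A n = D 0 n" by (simp add: A_def D_def)
      thus ?case using elim by (metis add_0)
    qed
    then obtain N where N: "\<And>n. n \<ge> N \<Longrightarrow> norm (D r n) \<le> C \<and> A n = D r n o\<^sub>L S r"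
      unfolding eventually_sequentially by blast
    have "totally_bounded (range (\<lambda>n. D r (n + N) y))" for y
      by (rule totally_bounded_subset[OF tbD[OF r(1), of y]]) auto
    from simultaneous_finite_net[of Y "\<lambda>n y. D r (n + N) y", OF Y(1) this d]
    obtain M where M: "finite M" "\<And>n. \<exists>m\<in>M. \<forall>y\<in>Y. dist (D r (n + N) y) (D r (m + N) y) < d"
      by metis
    have main: "dist (A m) (A n) < e"
      if nm: "n \<ge> N" "m \<ge> N" "\<forall>y\<in>Y. dist (D r n y) (D r m y) < d" for n m
    proof -
      define G where "G = D r n - D r m"
      have G: "norm G \<le> 2 * C"
        using N[OF nm(1)] N[OF nm(2)] norm_triangle_ineq4[of "D r n" "D r m"] unfolding G_def by linarith
      have AG: "(A n - A m) x = G (S r x)" for x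
        using N[OF nm(1)] N[OF nm(2)] by (simp add: G_def blinfun.diff_left)
      have unit: "norm ((A n - A m) x) \<le> (4 * C + 1) * d" if x: "norm x = 1" for x
      proof -
        obtain y where y: "y \<in> Y" "dist y (K x) < d" using Y(2)[of "K x"] x by auto
        have "norm ((S r - K) x) \<le> d" using norm_blinfun[of "S r - K" x] x r(3) by simp
        hence 1: "norm (G ((S r - K) x)) \<le> (2 * C) * d"
          using norm_blinfun[of G "(S r - K) x"] G C(2)
          by (meson less_imp_le mult_mono' norm_ge_zero order_trans)
        have "norm (K x - y) \<le> d" using y(2) by (simp add: dist_norm norm_minus_commute)
        hence 2: "norm (G (K x - y)) \<le> (2 * C) * d"
          using norm_blinfun[of G "K x - y"] G C(2)
          by (meson less_imp_le mult_mono' norm_ge_zero order_trans)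
        have 3: "norm (G y) \<le> d" using nm(3) y(1) by (auto simp: G_def dist_norm blinfun.diff_left)
        \<comment> \<open>\<open>S r x\<close> is moved to \<open>K x\<close> and then to the net
          point \<open>y\<close>. Both moves have length at most \<open>d\<close>, while
          \<open>G\<close> has norm at most \<open>2 * C\<close> and is small on the net.\<close>
        have eq: "(A n - A m) x = G ((S r - K) x) + G (K x - y) + G y"
          unfolding AG by (simp add: blinfun.diff_left blinfun.diff_right)
        have "norm ((A n - A m) x) \<le> norm (G ((S r - K) x)) + norm (G (K x - y)) + norm (G y)"
          unfolding eq by (intro norm_triangle_le add_mono norm_triangle_ineq order_refl)
        moreover have "(4 * C + 1) * d = (2 * C) * d + (2 * C) * d + d" by (simp add: algebra_simps)
        ultimately show ?thesis using 1 2 3 by linarith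
      qed
      have "norm (A n - A m) \<le> (4 * C + 1) * d"
      proof (rule norm_blinfun_bound)
        show "0 \<le> (4 * C + 1) * d" using C(2) d by simp
        fix x
        show "norm ((A n - A m) x) \<le> (4 * C + 1) * d * norm x"
        proof (cases "x = 0")
          case False
          hence "norm ((A n - A m) ((1 / norm x) *\<^sub>R x)) \<le> (4 * C + 1) * d" by (intro unit) simp
          hence "norm ((A n - A m) x) / norm x \<le> (4 * C + 1) * d" by (simp add: blinfun.scaleR_right)
          thus ?thesis using False by (simp add: pos_divide_le_eq)
        qed simp
      qed
      also have "\<dots> < e" using e C(2) by (simp add: d_def field_simps)
      finally show ?thesis by (simp add: dist_norm norm_minus_commute)
    qed
    have "range A \<subseteq> (\<Union>x \<in> A ` {..<N} \<union> (\<lambda>m. A (m + N)) ` M. {y. dist x y < e})"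
    proof (rule image_subsetI)
      fix n
      show "A n \<in> (\<Union>x \<in> A ` {..<N} \<union> (\<lambda>m. A (m + N)) ` M. {y. dist x y < e})"
      proof (cases "n < N")
        case True
        have "dist (A n) (A n) < e" using e by simp
        thus ?thesis using True by blast
      next
        case False
        obtain m where "m \<in> M" "\<forall>y\<in>Y. dist (D r n y) (D r (m + N) y) < d"
          using M(2)[of "n - N"] False by auto
        thus ?thesis using main[of n "m + N"] False by auto
      qed
    qed
    moreover have "finite (A ` {..<N} \<union> (\<lambda>m. A (m + N)) ` M)" using M(1) by simp
    ultimately show "\<exists>k. finite k \<and> range A \<subseteq> (\<Union>x\<in>k. {y. dist x y < e})" by blast
  qed
  then obtain l k where "strict_mono k" "(A \<circ> k) \<longlonglongrightarrow> l"
    by (rule totally_bounded_convergent_subseq)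
  thus ?thesis using that[of k l] by (simp add: A_def comp_def)
qed

section \<open>Boundedness\<close>

lemma blinfun_lim_apply:
  assumes "A \<longlonglongrightarrow> R"
  shows "(\<lambda>n. blinfun_apply (A n) x) \<longlonglongrightarrow> R x"
  using assms by (intro tendsto_intros)

lemma blinfun_lim_positive:
  fixes A :: "nat \<Rightarrow> ('a::banach_lattice \<Rightarrow>\<^sub>L 'a)"
  assumes "A \<longlonglongrightarrow> R" "\<And>n f. 0 \<le> f \<Longrightarrow> 0 \<le> A n f" "0 \<le> f"
  shows "0 \<le> R f"
  using blinfun_lim_apply[OF assms(1), of f] assms(2,3) tendsto_nonneg by blast

locale irreducible_compact_semigroup =
  fixes S :: "real \<Rightarrow> ('a::banach_lattice \<Rightarrow>\<^sub>L 'a)"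
  assumes semigroup: "op_semigroup S"
    and positive: "positive_semigroup S"
    and irreducible: "irreducible_semigroup S"
    and growth: "growth_bound S = 0"
    and asymp_compact: "asymptotically_compact S"
begin

lemma S_add: "0 < s \<Longrightarrow> 0 < t \<Longrightarrow> S (s + t) x = S s (S t x)"
  using op_semigroup_apply[OF semigroup] .

lemma S_comp: "0 < s \<Longrightarrow> 0 < t \<Longrightarrow> S s o\<^sub>L S t = S (s + t)"
  by (rule blinfun_eqI) (simp add: S_add)

lemma S_commute: "0 < s \<Longrightarrow> 0 < t \<Longrightarrow> S s (S t x) = S t (S s x)"
  using S_add[of s t x] S_add[of t s x] by (simp add: add.commute)

lemma S_nonneg: "0 < t \<Longrightarrow> 0 \<le> f \<Longrightarrow> 0 \<le> S t f"
  using positive unfolding positive_semigroup_def by blast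

lemma S_mult: "0 < s \<Longrightarrow> 0 < t \<Longrightarrow> norm (S (s + t)) \<le> norm (S s) * norm (S t)"
  using norm_blinfun_compose[of "S s" "S t"] by (simp add: S_comp)

text \<open>If \<open>R f = 0\<close>, then by commutation \<open>R\<close> vanishes on the whole
  orbit of \<open>f\<close>. But \<open>R \<noteq> 0\<close> yields a nonzero positive functional
  \<open>\<psi> o\<^sub>L R\<close>, which irreducibility makes positive somewhere on that
  orbit.\<close>

lemma positive_commuting_imp_strictly_positive:
  assumes R: "\<And>f. 0 \<le> f \<Longrightarrow> 0 \<le> blinfun_apply R f"
    and comm: "\<And>t f. 0 < t \<Longrightarrow> R (S t f) = S t (R f)"
    and "R \<noteq> 0" "0 \<le> f" "f \<noteq> 0"
  shows "R f \<noteq> 0"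
proof
  assume Rf: "R f = 0"
  obtain g where "R g \<noteq> 0" using \<open>R \<noteq> 0\<close> by (metis blinfun_eqI zero_blinfun.rep_eq)
  moreover have "R g = R (pprt g) - R (pprt (- g))"
    using prts[of g] pprt_neg[of g] by (metis blinfun.diff_right diff_minus_eq_add)
  ultimately obtain h where h: "0 \<le> h" "R h \<noteq> 0" by (metis diff_self zero_le_pprt)
  obtain \<psi> where \<psi>: "positive_functional \<psi>" "0 < \<psi> (R h)"
    using positive_functional_exists[OF R[OF h(1)] h(2)] by blast
  have "positive_functional (\<psi> o\<^sub>L R)"
    using \<psi>(1) R by (simp add: positive_functional_def)
  moreover have "\<psi> o\<^sub>L R \<noteq> 0" using \<psi>(2) by (metis blinfun_apply_blinfun_compose less_irrefl zero_blinfun.rep_eq)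
  ultimately obtain t where "0 < t" "0 < (\<psi> o\<^sub>L R) (S t f)"
    using irreducible assms(4,5) unfolding irreducible_semigroup_def by blast
  thus False using comm[of t f] Rf by simp
qed

lemma norm_S_le_exp:
  assumes "0 < w"
  obtains M where "0 < M" "\<And>t. 0 < t \<Longrightarrow> norm (S t) \<le> M * exp (w * t)"
proof -
  have "growth_bound S < ereal w" using growth assms by simp
  then obtain w' M where w: "w' < w" "M \<ge> 0" "\<And>t. t > 0 \<Longrightarrow> norm (S t) \<le> M * exp (w' * t)"
    unfolding growth_bound_def Inf_less_iff by auto
  have "norm (S t) \<le> (M + 1) * exp (w * t)" if "t > 0" for t
  proof -
    have "M * exp (w' * t) \<le> (M + 1) * exp (w * t)"
      using w that by (intro mult_mono) auto
    thus ?thesis using w(3)[OF that] by linarith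
  qed
  thus ?thesis using that[of "M + 1"] w(2) by simp
qed

text \<open>A single norm below 1 would by submultiplicativity give exponential decay and thus a
  negative growth bound.\<close>

lemma norm_S_ge_1:
  assumes "0 < t"
  shows "1 \<le> norm (S t)"
proof (rule ccontr)
  assume "\<not> 1 \<le> norm (S t)"
  then obtain q where q: "norm (S t) < q" "q < 1" by (metis dense not_le)
  hence q0: "q > 0" by (meson norm_ge_zero le_less_trans)
  obtain M where M: "0 < M" "\<And>s. 0 < s \<Longrightarrow> norm (S s) \<le> M * exp (1 * s)"
    using norm_S_le_exp[of 1] by auto
  define w where "w = ln q / t"
  have w: "w < 0" using q q0 assms by (simp add: w_def divide_neg_pos)
  have step: "norm (S (real n * t + r)) \<le> q ^ n * (M * exp t)" if "0 < r" "r \<le> t" for n r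
  proof (induction n)
    case 0
    have "M * exp r \<le> M * exp t" using M(1) that by simp
    thus ?case using M(2)[OF that(1)] by simp
  next
    case (Suc n)
    have "norm (S (t + (real n * t + r))) \<le> norm (S t) * norm (S (real n * t + r))"
      using assms that by (intro S_mult) (auto intro: add_nonneg_pos)
    also have "\<dots> \<le> q * (q ^ n * (M * exp t))"
      using Suc.IH q q0 by (intro mult_mono) auto
    finally show ?case by (simp add: algebra_simps)
  qed
  have "norm (S s) \<le> (M * exp t * exp (- w * t)) * exp (w * s)" if s: "0 < s" for s
  proof -
    \<comment> \<open>Ceiling minus one instead of the floor: the remainder
      \<open>s - real n * t\<close> then lies in \<open>(0, t]\<close> and is never 0, where nothing
      is known about \<open>S\<close>.\<close>
    define n where "n = nat (\<lceil>s / t\<rceil> - 1)"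
    have "\<lceil>s / t\<rceil> \<ge> 1" using s assms by simp
    hence rn: "real n = of_int \<lceil>s / t\<rceil> - 1" by (simp add: n_def)
    hence "real n < s / t" "s / t \<le> real n + 1" by linarith+
    hence n: "real n * t < s" "s \<le> real n * t + t" using assms by (simp_all add: field_simps)
    have "norm (S (real n * t + (s - real n * t))) \<le> q ^ n * (M * exp t)"
      using n by (intro step) auto
    also have "q ^ n = exp (real n * ln q)" using q0 by (simp add: exp_of_nat_mult)
    also have "real n * ln q = w * (real n * t)" using assms by (simp add: w_def)
    also have "exp (w * (real n * t)) * (M * exp t) \<le> exp (w * (s - t)) * (M * exp t)"
      using w n M(1) by (intro mult_right_mono) (auto intro: mult_left_mono_neg)
    also have "exp (w * (s - t)) = exp (- w * t) * exp (w * s)"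
      by (simp add: algebra_simps flip: exp_add)
    finally show ?thesis by (simp add: algebra_simps)
  qed
  hence "\<exists>M\<ge>0. \<forall>s>0. norm (S s) \<le> M * exp (w * s)"
    using M(1) by (intro exI[of _ "M * exp t * exp (- w * t)"]) auto
  hence "growth_bound S \<le> ereal w"
    unfolding growth_bound_def by (intro Inf_lower) blast
  thus False using w growth by simp
qed

text \<open>For \<open>l > 0\<close> the growth bound makes
  \<open>exp (- l * t) * norm (S t)\<close> bounded in \<open>t\<close>; \<open>tt n\<close> is a
  time at which more than half of its supremum is reached, for a weight \<open>l\<close> shrinking
  with \<open>n\<close>.\<close>

lemma near_maximal_times:
  assumes "\<not> (\<exists>C. \<forall>t>0. norm (S t) \<le> C)"
  obtains lam tt where "lam \<longlonglongrightarrow> 0" "filterlim tt at_top sequentially"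
    "filterlim (\<lambda>n. norm (S (tt n))) at_top sequentially"
    "\<And>n. 0 < lam n" "\<And>n. 0 < tt n"
    "\<And>n s. 0 < s \<Longrightarrow> norm (S s) \<le> 2 * exp (lam n * (s - tt n)) * norm (S (tt n))"
proof -
  have "\<exists>l t. 0 < l \<and> l \<le> 1 / real (Suc n) \<and> 0 < t \<and> real n \<le> norm (S t) \<and>
          (\<forall>s>0. norm (S s) \<le> 2 * exp (l * (s - t)) * norm (S t))" for n
  proof -
    obtain t0 where t0: "t0 > 0" "norm (S t0) > 4 * real n + 4" using assms by (meson not_le)
    \<comment> \<open>The first bound sends \<open>lam\<close> to 0. The second keeps the weight at
      \<open>t0\<close> at least 1/2, so that the threshold \<open>4 * real n + 4\<close> yields a
      supremum of at least \<open>2 * real n + 2\<close>.\<close>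
    define l where "l = min (1 / real (Suc n)) (ln 2 / t0)"
    have l: "0 < l" "l \<le> 1 / real (Suc n)" "l * t0 \<le> ln 2"
      using t0 by (auto simp: l_def min_def field_simps)
    obtain M where M: "0 < M" "\<And>s. 0 < s \<Longrightarrow> norm (S s) \<le> M * exp (l * s)"
      using norm_S_le_exp[OF l(1)] by blast
    define g where "g s = exp (- l * s) * norm (S s)" for s
    have bdd: "bdd_above (g ` {0<..})"
    proof (rule bdd_aboveI2)
      fix s :: real assume "s \<in> {0<..}"
      hence "g s \<le> exp (- l * s) * (M * exp (l * s))" unfolding g_def using M(2) by simp
      also have "\<dots> = M" by (simp add: mult.left_commute flip: exp_add)
      finally show "g s \<le> M" .
    qed
    define m where "m = (SUP s\<in>{0<..}. g s)"
    have gm: "g s \<le> m" if "s > 0" for s unfolding m_def using bdd that by (intro cSUP_upper) auto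
    have "exp (- l * t0) \<ge> 1 / 2"
    proof -
      have "exp (- ln 2) \<le> exp (- l * t0)" using l(3) by simp
      thus ?thesis by (simp add: exp_minus)
    qed
    hence "g t0 \<ge> 1 / 2 * (4 * real n + 4)" unfolding g_def using t0 by (intro mult_mono) auto
    hence m: "m \<ge> 2 * real n + 2" using gm[OF t0(1)] by simp
    hence "m / 2 < m" by simp
    then obtain t where t: "t > 0" "m / 2 < g t"
      unfolding m_def using less_cSUP_iff[OF _ bdd, of "m / 2"] by (auto simp: m_def)
    have "g t \<le> norm (S t)" unfolding g_def using l(1) t(1) by (intro mult_left_le_one_le) auto
    hence 1: "real n \<le> norm (S t)" using m t(2) by simp
    have "norm (S s) \<le> 2 * exp (l * (s - t)) * norm (S t)" if "s > 0" for s
    proof -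
      have "g s \<le> 2 * g t" using gm[OF that] t(2) by simp
      hence "exp (l * s) * g s \<le> exp (l * s) * (2 * g t)" by simp
      moreover have "exp (l * s) * g s = norm (S s)" by (simp add: g_def flip: mult.assoc exp_add)
      moreover have "exp (l * s) * (2 * g t) = 2 * exp (l * (s - t)) * norm (S t)"
        by (simp add: g_def right_diff_distrib exp_diff exp_minus field_simps)
      ultimately show ?thesis by simp
    qed
    thus ?thesis using l t(1) 1 by blast
  qed
  then obtain lam tt where L: "\<And>n. 0 < lam n" "\<And>n. lam n \<le> 1 / real (Suc n)" "\<And>n. 0 < tt n"
      "\<And>n. real n \<le> norm (S (tt n))"
      "\<And>n s. 0 < s \<Longrightarrow> norm (S s) \<le> 2 * exp (lam n * (s - tt n)) * norm (S (tt n))"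
    by metis
  have "lam \<longlonglongrightarrow> 0"
  proof (rule tendsto_sandwich[of "\<lambda>_. 0" _ _ "\<lambda>n. 1 / real (Suc n)"])
    show "(\<lambda>n. 1 / real (Suc n)) \<longlonglongrightarrow> 0" using LIMSEQ_inverse_real_of_nat by (simp add: inverse_eq_divide)
  qed (use L(1,2) in \<open>auto intro!: always_eventually less_imp_le\<close>)
  moreover have N: "filterlim (\<lambda>n. norm (S (tt n))) at_top sequentially"
    by (rule filterlim_at_top_mono[OF filterlim_real_sequentially]) (use L in auto)
  \<comment> \<open>Up to time \<open>b\<close> the norms stay below \<open>M * exp b\<close>, so
    large norms force large times.\<close>
  moreover have "filterlim tt at_top sequentially"
    unfolding filterlim_at_top
  proof
    fix b :: real
    obtain M where M: "0 < M" "\<And>s. 0 < s \<Longrightarrow> norm (S s) \<le> M * exp (1 * s)"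
      using norm_S_le_exp[of 1] by auto
    have "eventually (\<lambda>n. norm (S (tt n)) > M * exp b) sequentially"
      using N by (simp add: filterlim_at_top_dense)
    thus "eventually (\<lambda>n. b \<le> tt n) sequentially"
    proof eventually_elim
      case (elim n)
      hence "M * exp b < M * exp (tt n)" using M(2)[OF L(3), of n] by simp
      thus ?case using M(1) by simp
    qed
  qed
  ultimately show ?thesis using that L by blast
qed

text \<open>If \<open>S\<close> were unbounded, a limit \<open>R\<close> of normalised operators along almost maximising times of
  \<open>exp (- \<lambda> t) \<parallel>S t\<parallel>\<close>, \<open>\<lambda> \<down> 0\<close>, would satisfy \<open>\<parallel>S s R\<parallel> \<le> 2\<close> for all \<open>s\<close>, whence \<open>R\<^sup>2 = 0\<close>;
  but \<open>R\<close> is strictly positive.\<close>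

lemma bounded_S: obtains C where "0 < C" "\<And>t. 0 < t \<Longrightarrow> norm (S t) \<le> C"
proof (cases "\<exists>C. \<forall>t>0. norm (S t) \<le> C")
  case True
  then obtain C where "\<And>t. t > 0 \<Longrightarrow> norm (S t) \<le> C" by blast
  thus ?thesis using that[of "max C 1"] by (meson less_max_iff_disj max.coboundedI1 zero_less_one)
next
  case False
  then obtain lam tt where L: "lam \<longlonglongrightarrow> 0" "filterlim tt at_top sequentially"
    "filterlim (\<lambda>n. norm (S (tt n))) at_top sequentially"
    "\<And>n. 0 < lam n" "\<And>n. 0 < tt n"
    "\<And>n s. 0 < s \<Longrightarrow> norm (S s) \<le> 2 * exp (lam n * (s - tt n)) * norm (S (tt n))"
    using near_maximal_times by blast
  have c: "norm (S (tt n)) > 0" for n using norm_S_ge_1[OF L(5)[of n]] by linarith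
  have "eventually (\<lambda>n. norm (S (tt n - r)) \<le> 2 * norm (S (tt n))) sequentially" if r: "r > 0" for r
  proof -
    have "eventually (\<lambda>n. tt n > r) sequentially" using L(2) by (simp add: filterlim_at_top_dense)
    thus ?thesis
    proof eventually_elim
      case (elim n)
      have "norm (S (tt n - r)) \<le> 2 * exp (lam n * (tt n - r - tt n)) * norm (S (tt n))"
        using elim by (intro L(6)) simp
      also have "\<dots> \<le> 2 * 1 * norm (S (tt n))"
        using L(4)[of n] r by (intro mult_right_mono mult_left_mono) auto
      finally show ?case by simp
    qed
  qed
  from semigroup_convergent_subseq[OF semigroup asymp_compact L(2) c this zero_less_numeral]
  obtain R k where k: "strict_mono k"
    and R: "(\<lambda>n. (1 / norm (S (tt (k n)))) *\<^sub>R S (tt (k n))) \<longlonglongrightarrow> R" by metis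
  define A where "A n = (1 / norm (S (tt (k n)))) *\<^sub>R S (tt (k n))" for n
  have A: "A \<longlonglongrightarrow> R" using R unfolding A_def .
  have A1: "norm (A n) = 1" for n using c[of "k n"] by (simp add: A_def)
  have "(\<lambda>n. norm (A n)) \<longlonglongrightarrow> norm R" using A by (rule tendsto_norm)
  hence "norm R = 1" unfolding A1 by (simp add: LIMSEQ_const_iff)
  hence R0: "R \<noteq> 0" by auto
  have Rpos: "0 \<le> R f" if "0 \<le> f" for f
    by (rule blinfun_lim_positive[OF A _ that])
       (use L(5) in \<open>auto simp: A_def blinfun.scaleR_left intro!: scaleR_nonneg_nonneg S_nonneg\<close>)
  have Rcomm: "R (S t f) = S t (R f)" if "0 < t" for t f
  proof (rule LIMSEQ_unique)
    show "(\<lambda>n. A n (S t f)) \<longlonglongrightarrow> R (S t f)" by (rule blinfun_lim_apply[OF A])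
    have "(\<lambda>n. S t (A n f)) \<longlonglongrightarrow> S t (R f)"
      by (intro blinfun.tendsto tendsto_const blinfun_lim_apply[OF A])
    moreover have "S t (A n f) = A n (S t f)" for n
      using S_commute[OF that L(5)] by (simp add: A_def blinfun.scaleR_left blinfun.scaleR_right)
    ultimately show "(\<lambda>n. A n (S t f)) \<longlonglongrightarrow> S t (R f)" by simp
  qed
  \<comment> \<open>As \<open>lam\<close> tends to 0, the bound
    \<open>2 * exp (lam (k n) * s)\<close> loses its dependence on \<open>s\<close> in the
    limit.\<close>
  have SR: "norm (S s o\<^sub>L R) \<le> 2" if s: "0 < s" for s
  proof -
    have "(\<lambda>n. norm (S s o\<^sub>L A n)) \<longlonglongrightarrow> norm (S s o\<^sub>L R)"
      by (intro tendsto_norm bounded_bilinear.tendsto[OF bounded_bilinear_blinfun_compose] tendsto_const A)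
    moreover have "(\<lambda>n. 2 * exp (lam (k n) * s)) \<longlonglongrightarrow> 2 * exp (0 * s)"
      using LIMSEQ_subseq_LIMSEQ[OF L(1) k] by (intro tendsto_intros) (simp add: comp_def)
    moreover have "norm (S s o\<^sub>L A n) \<le> 2 * exp (lam (k n) * s)" for n
    proof -
      have "S s o\<^sub>L A n = (1 / norm (S (tt (k n)))) *\<^sub>R S (s + tt (k n))"
        by (rule blinfun_eqI) (simp add: A_def blinfun.scaleR_left blinfun.scaleR_right S_add s L(5))
      moreover have "norm (S (s + tt (k n))) \<le> 2 * exp (lam (k n) * s) * norm (S (tt (k n)))"
        using L(6)[of "s + tt (k n)" "k n"] s L(5)[of "k n"] by simp
      ultimately show ?thesis using c[of "k n"] by (simp add: field_simps)
    qed
    ultimately have "norm (S s o\<^sub>L R) \<le> 2 * exp (0 * s)" by (intro LIMSEQ_le) auto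
    thus ?thesis by simp
  qed
  have RR: "R o\<^sub>L R = 0"
  proof (rule LIMSEQ_unique)
    show "(\<lambda>n. A n o\<^sub>L R) \<longlonglongrightarrow> (R o\<^sub>L R)"
      by (intro bounded_bilinear.tendsto[OF bounded_bilinear_blinfun_compose] tendsto_const A)
    \<comment> \<open>\<open>A n o\<^sub>L R\<close> is \<open>S (tt (k n)) o\<^sub>L R\<close>, of
      norm at most 2, divided by a norm that tends to infinity.\<close>
    have lim: "(\<lambda>n. 2 / norm (S (tt (k n)))) \<longlonglongrightarrow> 0"
      using filterlim_compose[OF L(3) filterlim_subseq[OF k]]
      by (intro tendsto_divide_0[OF tendsto_const]) (simp add: filterlim_at_top_imp_at_infinity)
    show "(\<lambda>n. A n o\<^sub>L R) \<longlonglongrightarrow> 0"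
    proof (rule Lim_null_comparison[OF always_eventually lim], rule allI)
      fix n
      have "A n o\<^sub>L R = (1 / norm (S (tt (k n)))) *\<^sub>R (S (tt (k n)) o\<^sub>L R)"
        by (rule blinfun_eqI) (simp add: A_def blinfun.scaleR_left)
      thus "norm (A n o\<^sub>L R) \<le> 2 / norm (S (tt (k n)))"
        using SR[OF L(5), of "k n"] c[of "k n"] by (simp add: divide_right_mono)
    qed
  qed
  have strict: "R f \<noteq> 0" if "0 \<le> f" "f \<noteq> 0" for f
    by (rule positive_commuting_imp_strictly_positive[OF Rpos Rcomm R0 that])
  have "R f = 0" if "0 \<le> f" for f
  proof (rule ccontr)
    assume "R f \<noteq> 0"
    hence "R (R f) \<noteq> 0" using strict Rpos that by blast
    thus False using RR by (metis blinfun_apply_blinfun_compose zero_blinfun.rep_eq)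
  qed
  \<comment> \<open>\<open>R\<close> is both zero and injective at 0 on the positive cone, so the
    whole space is trivial, against \<open>R \<noteq> 0\<close>.\<close>
  hence "pprt g = 0" for g :: 'a using strict[of "pprt g"] by auto
  hence "g = 0" for g :: 'a using prts[of g] pprt_neg[of g] by simp
  hence "R = 0" by (intro blinfun_eqI) metis
  thus ?thesis using R0 by simp
qed

end

section \<open>The group of limit points\<close>

context irreducible_compact_semigroup
begin

text \<open>The omega-limit set of \<open>S\<close> in operator norm.\<close>

definition limit_points :: "('a \<Rightarrow>\<^sub>L 'a) set" where
  "limit_points = {R. \<exists>t. filterlim t at_top sequentially \<and> (\<forall>n. 0 < t n) \<and> (\<lambda>n. S (t n)) \<longlonglongrightarrow> R}"

lemma convergent_subseq:
  assumes "filterlim t at_top sequentially" "\<And>n. 0 < t n"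
  obtains R k where "R \<in> limit_points" "strict_mono k" "(\<lambda>n. S (t (k n))) \<longlonglongrightarrow> R"
proof -
  obtain C where C: "0 < C" "\<And>t. 0 < t \<Longrightarrow> norm (S t) \<le> C" using bounded_S by blast
  have "eventually (\<lambda>n. norm (S (t n - r)) \<le> C * 1) sequentially" if r: "r > 0" for r
  proof -
    have "eventually (\<lambda>n. t n > r) sequentially" using assms(1) by (simp add: filterlim_at_top_dense)
    thus ?thesis by eventually_elim (use C(2) in auto)
  qed
  from semigroup_convergent_subseq[OF semigroup asymp_compact assms(1) zero_less_one this C(1)]
  obtain R k where k: "strict_mono k" "(\<lambda>n. S (t (k n))) \<longlonglongrightarrow> R"
    unfolding div_by_1 scaleR_one by metis
  have "filterlim (\<lambda>n. t (k n)) at_top sequentially"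
    using filterlim_compose[OF assms(1) filterlim_subseq[OF k(1)]] .
  hence "R \<in> limit_points" unfolding limit_points_def using k(2) assms(2) by auto
  thus ?thesis using that k by blast
qed

lemma limit_point_positive: "R \<in> limit_points \<Longrightarrow> 0 \<le> f \<Longrightarrow> 0 \<le> R f"
  unfolding limit_points_def using blinfun_lim_positive[of _ R f] S_nonneg by blast

lemma limit_point_commute_S:
  assumes "R \<in> limit_points" "0 < t"
  shows "R o\<^sub>L S t = S t o\<^sub>L R"
proof -
  obtain s where s: "\<And>n. 0 < s n" "(\<lambda>n. S (s n)) \<longlonglongrightarrow> R"
    using assms(1) unfolding limit_points_def by blast
  have "(\<lambda>n. S (s n) o\<^sub>L S t) \<longlonglongrightarrow> (R o\<^sub>L S t)" "(\<lambda>n. S t o\<^sub>L S (s n)) \<longlonglongrightarrow> (S t o\<^sub>L R)"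
    by (intro bounded_bilinear.tendsto[OF bounded_bilinear_blinfun_compose] tendsto_const s)+
  moreover have "S (s n) o\<^sub>L S t = S t o\<^sub>L S (s n)" for n
    using s(1) assms(2) by (simp add: S_comp add.commute)
  ultimately show ?thesis using LIMSEQ_unique by auto
qed

lemma limit_point_commute:
  assumes "R \<in> limit_points" "Q \<in> limit_points"
  shows "R o\<^sub>L Q = Q o\<^sub>L R"
proof -
  obtain s where s: "\<And>n. 0 < s n" "(\<lambda>n. S (s n)) \<longlonglongrightarrow> R"
    using assms(1) unfolding limit_points_def by blast
  have "(\<lambda>n. S (s n) o\<^sub>L Q) \<longlonglongrightarrow> (R o\<^sub>L Q)" "(\<lambda>n. Q o\<^sub>L S (s n)) \<longlonglongrightarrow> (Q o\<^sub>L R)"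
    by (intro bounded_bilinear.tendsto[OF bounded_bilinear_blinfun_compose] tendsto_const s)+
  moreover have "Q o\<^sub>L S (s n) = S (s n) o\<^sub>L Q" for n
    using s(1) limit_point_commute_S[OF assms(2)] by simp
  ultimately show ?thesis using LIMSEQ_unique by auto
qed

lemma limit_point_nonzero:
  assumes "R \<in> limit_points"
  shows "R \<noteq> 0"
proof -
  obtain s where s: "\<And>n. 0 < s n" "(\<lambda>n. S (s n)) \<longlonglongrightarrow> R"
    using assms(1) unfolding limit_points_def by blast
  have "1 \<le> norm R"
    using tendsto_norm[OF s(2)] norm_S_ge_1[OF s(1)] by (intro LIMSEQ_le_const) auto
  thus ?thesis by auto
qed

lemma limit_point_shift:
  assumes "R \<in> limit_points" "0 < t"
  shows "S t o\<^sub>L R \<in> limit_points"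
proof -
  obtain s where s: "filterlim s at_top sequentially" "\<And>n. 0 < s n" "(\<lambda>n. S (s n)) \<longlonglongrightarrow> R"
    using assms(1) unfolding limit_points_def by blast
  have "(\<lambda>n. S t o\<^sub>L S (s n)) \<longlonglongrightarrow> (S t o\<^sub>L R)"
    by (intro bounded_bilinear.tendsto[OF bounded_bilinear_blinfun_compose] tendsto_const s)
  hence "(\<lambda>n. S (t + s n)) \<longlonglongrightarrow> (S t o\<^sub>L R)" using s(2) assms(2) by (simp add: S_comp)
  moreover have "filterlim (\<lambda>n. t + s n) at_top sequentially"
    using s(1) by (intro filterlim_tendsto_add_at_top[OF tendsto_const])
  moreover have "0 < t + s n" for n using s(2)[of n] assms(2) by simp
  ultimately show ?thesis unfolding limit_points_def by blast
qed

text \<open>If \<open>S (t n)\<close> tends to \<open>R\<close> and \<open>S (s n)\<close> to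
  \<open>Q\<close>, thin out \<open>s\<close> until the differences \<open>s (k n) - t n\<close>
  tend to infinity; a limit of \<open>S\<close> along them is the quotient. This gives the group
  structure.\<close>

lemma limit_point_quotient:
  assumes "R \<in> limit_points" "Q \<in> limit_points"
  obtains W where "W \<in> limit_points" "Q = W o\<^sub>L R"
proof -
  obtain t where t: "filterlim t at_top sequentially" "\<And>n. 0 < t n" "(\<lambda>n. S (t n)) \<longlonglongrightarrow> R"
    using assms(1) unfolding limit_points_def by blast
  obtain s where s: "filterlim s at_top sequentially" "\<And>n. 0 < s n" "(\<lambda>n. S (s n)) \<longlonglongrightarrow> Q"
    using assms(2) unfolding limit_points_def by blast
  \<comment> \<open>The margin \<open>real n + 1\<close> makes the differences positive and
    divergent; \<open>m \<ge> n\<close> makes the selected indices tend to infinity.\<close>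
  have "\<exists>m\<ge>n. t n + real n + 1 \<le> s m" for n
  proof -
    have "eventually (\<lambda>m. t n + real n + 1 \<le> s m \<and> m \<ge> n) sequentially"
      using s(1) by (auto simp: filterlim_at_top intro: eventually_conj eventually_ge_at_top)
    then obtain m where "t n + real n + 1 \<le> s m \<and> m \<ge> n"
      unfolding eventually_sequentially by blast
    thus ?thesis by blast
  qed
  then obtain k where k: "\<And>n. n \<le> k n" "\<And>n. t n + real n + 1 \<le> s (k n)" by metis
  have klim: "filterlim k at_top sequentially"
    by (rule filterlim_at_top_mono[OF filterlim_ident]) (simp add: k)
  define d where "d n = s (k n) - t n" for n
  have d: "real n \<le> d n" "0 < d n" for n using k(2)[of n] by (simp_all add: d_def)
  have "filterlim d at_top sequentially"
    using d(1) by (intro filterlim_at_top_mono[OF filterlim_real_sequentially] always_eventually allI)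
  moreover note d0 = d(2)
  ultimately obtain W j where W: "W \<in> limit_points" "strict_mono j" "(\<lambda>n. S (d (j n))) \<longlonglongrightarrow> W"
    using convergent_subseq[of d] by blast
  have "(\<lambda>n. S (d (j n)) o\<^sub>L S (t (j n))) \<longlonglongrightarrow> (W o\<^sub>L R)"
    using LIMSEQ_subseq_LIMSEQ[OF t(3) W(2)]
    by (intro bounded_bilinear.tendsto[OF bounded_bilinear_blinfun_compose] W) (simp add: comp_def)
  moreover have "S (d (j n)) o\<^sub>L S (t (j n)) = S (s (k (j n)))" for n
    using d0 t(2) by (simp add: S_comp) (simp add: d_def)
  moreover have "(\<lambda>n. S (s (k (j n)))) \<longlonglongrightarrow> Q"
    using filterlim_compose[OF s(3) filterlim_compose[OF klim filterlim_subseq[OF W(2)]]] .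
  ultimately have "Q = W o\<^sub>L R" using LIMSEQ_unique by auto
  thus ?thesis using W that by blast
qed

text \<open>Divide some \<open>R\<close> by itself to get \<open>R = P o\<^sub>L R\<close>. Every
  \<open>Q\<close> has the form \<open>R o\<^sub>L W\<close> by divisibility and commutativity, so
  \<open>P\<close> fixes it as well.\<close>

lemma limit_point_unit:
  obtains P where "P \<in> limit_points" "\<And>Q. Q \<in> limit_points \<Longrightarrow> P o\<^sub>L Q = Q"
proof -
  have "filterlim (\<lambda>n. real n + 1) at_top sequentially"
    by (rule filterlim_at_top_mono[OF filterlim_real_sequentially]) auto
  then obtain R where R: "R \<in> limit_points"
    using convergent_subseq[of "\<lambda>n. real n + 1"] by (metis add_nonneg_pos of_nat_0_le_iff zero_less_one)
  obtain P where P: "P \<in> limit_points" "R = P o\<^sub>L R" using limit_point_quotient[OF R R] by blast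
  have "P o\<^sub>L Q = Q" if Q: "Q \<in> limit_points" for Q
  proof -
    obtain W where W: "W \<in> limit_points" "Q = W o\<^sub>L R" using limit_point_quotient[OF R Q] by blast
    have "Q = R o\<^sub>L W" using W limit_point_commute[OF W(1) R] by simp
    moreover have "P o\<^sub>L (R o\<^sub>L W) = (P o\<^sub>L R) o\<^sub>L W" by (rule blinfun_eqI) simp
    ultimately show ?thesis using P(2) by simp
  qed
  thus ?thesis using P(1) that by blast
qed

end

section \<open>The limit projection and the lattice structure of its range\<close>

locale limit_projection = irreducible_compact_semigroup +
  fixes P
  assumes P_limit: "P \<in> limit_points"
    and P_unit: "\<And>Q. Q \<in> limit_points \<Longrightarrow> P o\<^sub>L Q = Q"
begin

definition F where "F = {x. P x = x}"

lemma P_nonneg: "0 \<le> f \<Longrightarrow> 0 \<le> P f"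
  using limit_point_positive[OF P_limit] .

lemma P_mono: "f \<le> g \<Longrightarrow> P f \<le> P g"
  using P_nonneg[of "g - f"] by (simp add: blinfun.diff_right)

lemma S_mono: "0 < t \<Longrightarrow> f \<le> g \<Longrightarrow> S t f \<le> S t g"
  using S_nonneg[of t "g - f"] by (simp add: blinfun.diff_right)

lemma P_in_F: "P x \<in> F"
  using arg_cong[OF P_unit[OF P_limit], of "\<lambda>A. blinfun_apply A x"] by (simp add: F_def)

lemma P_S: "0 < t \<Longrightarrow> P (S t x) = S t (P x)"
  using arg_cong[OF limit_point_commute_S[OF P_limit], of t "\<lambda>A. blinfun_apply A x"] by simp

lemma P_strict: "0 \<le> f \<Longrightarrow> f \<noteq> 0 \<Longrightarrow> P f \<noteq> 0"
  using positive_commuting_imp_strictly_positive[OF P_nonneg P_S limit_point_nonzero[OF P_limit]] .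

lemma F_diff: "x \<in> F \<Longrightarrow> y \<in> F \<Longrightarrow> x - y \<in> F"
  and F_scaleR: "x \<in> F \<Longrightarrow> c *\<^sub>R x \<in> F"
  and F_S: "x \<in> F \<Longrightarrow> 0 < t \<Longrightarrow> S t x \<in> F"
  by (auto simp: F_def blinfun.diff_right blinfun.scaleR_right P_S)

text \<open>Positivity gives \<open>P (inf x y) \<le> inf x y\<close>. The difference is positive
  and annihilated by the idempotent \<open>P\<close>, hence zero by strict positivity.\<close>

lemma F_inf:
  assumes "x \<in> F" "y \<in> F"
  shows "inf x y \<in> F"
proof -
  have "P (inf x y) \<le> P x" "P (inf x y) \<le> P y" by (intro P_mono; simp)+
  hence "0 \<le> inf x y - P (inf x y)" using assms by (simp add: F_def)
  moreover have "P (inf x y - P (inf x y)) = 0"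
    using P_in_F[of "inf x y"] by (simp add: F_def blinfun.diff_right)
  ultimately have "inf x y - P (inf x y) = 0" using P_strict by blast
  thus ?thesis by (simp add: F_def)
qed

text \<open>Dividing the unit \<open>P\<close> by the limit point \<open>S t o\<^sub>L P\<close>
  gives a limit point \<open>W\<close>; as such it is positive and commutes with
  \<open>S t\<close>.\<close>

lemma S_inverse:
  assumes "0 < t"
  shows "\<exists>W. mono (blinfun_apply W) \<and> (\<forall>x\<in>F. W (S t x) = x \<and> S t (W x) = x \<and> W x \<in> F)"
proof -
  obtain W where W: "W \<in> limit_points" "P = W o\<^sub>L (S t o\<^sub>L P)"
    using limit_point_quotient[OF limit_point_shift[OF P_limit assms] P_limit] by blast
  have "W (S t x) = x" if "x \<in> F" for x
    using arg_cong[OF W(2), of "\<lambda>A. blinfun_apply A x"] that by (simp add: F_def)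
  moreover have "S t (W x) = W (S t x)" for x
    using arg_cong[OF limit_point_commute_S[OF W(1) assms], of "\<lambda>A. blinfun_apply A x"] by simp
  moreover have "W x \<in> F" for x
    using arg_cong[OF P_unit[OF W(1)], of "\<lambda>A. blinfun_apply A x"] by (simp add: F_def)
  moreover have "mono (blinfun_apply W)"
  proof (rule monoI)
    fix f g :: 'a assume "f \<le> g"
    thus "W f \<le> W g" using limit_point_positive[OF W(1), of "g - f"] by (simp add: blinfun.diff_right)
  qed
  ultimately show ?thesis by (intro exI[of _ W]) simp
qed

text \<open>\<open>S t\<close> is an order isomorphism of \<open>F\<close>: its inverse
  \<open>W\<close> is monotone too, which gives the nontrivial inequality.\<close>

lemma S_inf:
  assumes "0 < t" "x \<in> F" "y \<in> F"
  shows "S t (inf x y) = inf (S t x) (S t y)"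
proof (rule antisym)
  show "S t (inf x y) \<le> inf (S t x) (S t y)" using assms(1) by (simp add: S_mono)
  obtain W where "mono (blinfun_apply W)" and inv: "\<forall>x\<in>F. W (S t x) = x \<and> S t (W x) = x \<and> W x \<in> F"
    using S_inverse[OF assms(1)] by blast
  hence Wmono: "W f \<le> W g" if "f \<le> g" for f g using that by (simp add: monoD)
  have W: "W (S t x) = x" "S t (W x) = x" "W x \<in> F" if "x \<in> F" for x using inv that by auto
  let ?z = "inf (S t x) (S t y)"
  have "?z \<in> F" using assms by (intro F_inf F_S)
  have "W ?z \<le> W (S t x)" "W ?z \<le> W (S t y)" by (intro Wmono; simp)+
  hence "W ?z \<le> inf x y" using assms W(1) by simp
  hence "S t (W ?z) \<le> S t (inf x y)" using assms(1) by (simp add: S_mono)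
  thus "?z \<le> S t (inf x y)" using W(2)[OF \<open>?z \<in> F\<close>] by simp
qed

lemma S_eq_0:
  assumes "0 < t" "x \<in> F" "S t x = 0"
  shows "x = 0"
proof -
  obtain W where "blinfun_apply W (S t x) = x" using S_inverse[OF assms(1)] assms(2) by blast
  thus ?thesis using assms(3) by simp
qed

text \<open>\<open>P\<close> is a norm limit of operators whose essential norms tend to 0, hence a
  norm limit of compact operators.\<close>

lemma P_totally_bounded: "totally_bounded (blinfun_apply P ` ball 0 2)"
proof (rule totally_bounded_approx)
  fix e :: real assume e: "e > 0"
  obtain t where t: "filterlim t at_top sequentially" "(\<lambda>n. S (t n)) \<longlonglongrightarrow> P"
    using P_limit unfolding limit_points_def by blast
  have "(\<lambda>n. ess_norm (S (t n))) \<longlonglongrightarrow> 0"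
    using filterlim_compose[OF asymp_compact[unfolded asymptotically_compact_def] t(1)] .
  hence "eventually (\<lambda>n. ess_norm (S (t n)) < e / 4) sequentially"
    using e by (intro order_tendstoD) auto
  moreover have "eventually (\<lambda>n. dist (S (t n)) P < e / 4) sequentially"
    using t(2) e by (intro tendstoD) auto
  ultimately have "eventually (\<lambda>n. ess_norm (S (t n)) < e / 4 \<and> dist (S (t n)) P < e / 4) sequentially"
    by (rule eventually_conj)
  then obtain s where s: "ess_norm (S s) < e / 4" "dist (S s) P < e / 4"
    unfolding eventually_sequentially by blast
  obtain K where K: "compact_operator K" "norm (S s - K) < e / 4"
    using ess_norm_less_compact_approx[OF s(1)] by blast
  have "norm (P - K) < e / 2"
    using norm_triangle_ineq[of "P - S s" "S s - K"] s(2) K(2) by (simp add: dist_norm norm_minus_commute)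
  moreover have "dist (P x) (K x) \<le> norm (P - K) * norm x" for x
    using norm_blinfun[of "P - K" x] by (simp add: dist_norm blinfun.diff_left)
  moreover have "norm (P - K) * norm x \<le> norm (P - K) * 2" if "x \<in> ball 0 2" for x
    using that by (intro mult_left_mono) auto
  ultimately have "dist (P x) (K x) < e" if "x \<in> ball 0 2" for x
    using that by (smt (verit) field_sum_of_halves)
  hence "\<forall>y\<in>blinfun_apply P ` ball 0 2. \<exists>z\<in>blinfun_apply K ` ball 0 2. dist y z < e" by blast
  thus "\<exists>Y. totally_bounded Y \<and> (\<forall>x\<in>blinfun_apply P ` ball 0 2. \<exists>y\<in>Y. dist x y < e)"
    using compact_operator_totally_bounded_ball[OF K(1)] by blast
qed

section \<open>Atoms of the range of the limit projection\<close>

definition disjoint_system where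
  "disjoint_system A \<longleftrightarrow> A \<subseteq> F \<and> (\<forall>a\<in>A. 0 \<le> a \<and> a \<noteq> 0) \<and> pairwise (\<lambda>a b. inf a b = 0) A"

text \<open>Normalised members of a system have mutual distance at least 1 and lie in a totally
  bounded set, so distinct members need distinct centres of a net of radius 1/2.\<close>

lemma disjoint_card_bound: "\<exists>N. \<forall>A. disjoint_system A \<longrightarrow> card A \<le> N"
proof -
  have "(0::real) < 1 / 2" by simp
  from totally_bounded_finite_net[OF P_totally_bounded this]
  obtain k where k: "finite k" "\<And>x. x \<in> blinfun_apply P ` ball 0 2 \<Longrightarrow> \<exists>c\<in>k. dist c x < 1 / 2"
    by metis
  have "card A \<le> card k" if "disjoint_system A" for A
  proof -
    have A: "A \<subseteq> F" "\<And>a. a \<in> A \<Longrightarrow> 0 \<le> a \<and> a \<noteq> 0"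
      "\<And>a b. a \<in> A \<Longrightarrow> b \<in> A \<Longrightarrow> a \<noteq> b \<Longrightarrow> inf a b = 0"
      using that unfolding disjoint_system_def pairwise_def by blast+
    define n where "n a = (1 / norm a) *\<^sub>R a" for a :: 'a
    have "\<exists>c\<in>k. dist c (n a) < 1 / 2" if "a \<in> A" for a
    proof (rule k(2))
      have "norm (n a) < 2" using A(2)[OF that] by (simp add: n_def)
      moreover have "n a = P (n a)" using that A(1) F_scaleR by (auto simp: F_def n_def)
      ultimately show "n a \<in> blinfun_apply P ` ball 0 2" by (intro image_eqI) auto
    qed
    then obtain c where c: "\<And>a. a \<in> A \<Longrightarrow> c a \<in> k" "\<And>a. a \<in> A \<Longrightarrow> dist (c a) (n a) < 1 / 2"
      by metis
    have "inj_on c A"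
    proof (rule inj_onI, rule ccontr)
      fix a b assume ab: "a \<in> A" "b \<in> A" "c a = c b" "a \<noteq> b"
      have "inf (n a) (n b) = 0"
        unfolding n_def using A(2) A(3)[OF ab(1,2,4)] ab by (intro inf_scaleR_eq_0) auto
      moreover have "0 \<le> n a" "0 \<le> n b" using A(2) ab by (auto simp: n_def intro!: scaleR_nonneg_nonneg)
      ultimately have "norm (n a) \<le> norm (n a - n b)" by (intro norm_le_norm_diff_disjoint)
      moreover have "norm (n a) = 1" using A(2)[OF ab(1)] by (simp add: n_def)
      moreover have "dist (n a) (n b) < 1"
        using c(2)[OF ab(1)] c(2)[OF ab(2)] ab(3) dist_triangle_half_r[of "c a" "n a" 1 "n b"] by simp
      ultimately show False by (simp add: dist_norm)
    qed
    thus ?thesis using c(1) k(1) by (intro card_inj_on_le[of c]) auto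
  qed
  thus ?thesis by blast
qed

text \<open>Atoms are encoded by indecomposability: no two disjoint nonzero parts within
  \<open>F\<close>. This form is carried along directly by lattice isomorphisms; proportionality is
  derived in \<open>meeting_atoms_proportional\<close>.\<close>

definition atom where
  "atom a \<longleftrightarrow> a \<in> F \<and> 0 \<le> a \<and> a \<noteq> 0 \<and>
     (\<forall>x\<in>F. \<forall>y\<in>F. 0 \<le> x \<longrightarrow> x \<le> a \<longrightarrow> 0 \<le> y \<longrightarrow> y \<le> a \<longrightarrow> inf x y = 0 \<longrightarrow> x = 0 \<or> y = 0)"

lemma atomD:
  "atom a \<Longrightarrow> a \<in> F" "atom a \<Longrightarrow> 0 \<le> a" "atom a \<Longrightarrow> a \<noteq> 0"
  "atom a \<Longrightarrow> x \<in> F \<Longrightarrow> y \<in> F \<Longrightarrow> 0 \<le> x \<Longrightarrow> x \<le> a \<Longrightarrow> 0 \<le> y \<Longrightarrow> y \<le> a \<Longrightarrow> inf x y = 0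
     \<Longrightarrow> x = 0 \<or> y = 0"
  unfolding atom_def by blast+

text \<open>Split \<open>x\<close> into two disjoint nonzero parts, continue inside one and keep the
  other. The bound by \<open>x\<close> is carried through the induction so that the part kept stays
  disjoint from the rest.\<close>

lemma disjoint_system_if_no_atom:
  assumes "\<nexists>a. atom a" "x \<in> F" "0 \<le> x" "x \<noteq> 0"
  shows "\<exists>A. disjoint_system A \<and> finite A \<and> card A = n \<and> (\<forall>a\<in>A. a \<le> x)"
  using assms(2-4)
proof (induction n arbitrary: x)
  case 0
  show ?case by (intro exI[of _ "{}"]) (auto simp: disjoint_system_def)
next
  case (Suc n)
  obtain y z where yz: "y \<in> F" "z \<in> F" "0 \<le> y" "y \<le> x" "0 \<le> z" "z \<le> x" "inf y z = 0" "y \<noteq> 0" "z \<noteq> 0"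
    using assms(1) Suc.prems unfolding atom_def by blast
  obtain A where A: "disjoint_system A" "finite A" "card A = n" "\<forall>a\<in>A. a \<le> y"
    using Suc.IH[OF yz(1,3,8)] by blast
  have az: "inf a z = 0" if "a \<in> A" for a
  proof (rule antisym)
    have "inf a z \<le> inf y z" using A(4) that by (intro inf_mono) auto
    thus "inf a z \<le> 0" using yz(7) by simp
    show "0 \<le> inf a z" using A(1) that yz(5) by (simp add: disjoint_system_def)
  qed
  have "z \<notin> A" using az[of z] yz(9) by auto
  hence "card (insert z A) = Suc n" using A(2,3) by simp
  moreover have "disjoint_system (insert z A)"
    using A(1) yz az unfolding disjoint_system_def pairwise_insert by (auto simp: inf_commute[of z])
  moreover have "\<forall>a\<in>insert z A. a \<le> x" using A(4) yz(4,6) by (auto intro: order_trans)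
  ultimately show ?case using A(2) by (meson finite_insert)
qed

lemma atom_exists: "\<exists>a. atom a"
proof -
  obtain x where "P x \<noteq> 0"
    using limit_point_nonzero[OF P_limit] by (metis blinfun_eqI zero_blinfun.rep_eq)
  hence "x \<noteq> 0" by auto
  then obtain g :: 'a where g: "0 \<le> g" "g \<noteq> 0"
    using prts[of x] pprt_neg[of x] by (metis add.right_neutral neg_equal_0_iff_equal zero_le_pprt)
  obtain N where N: "\<forall>A. disjoint_system A \<longrightarrow> card A \<le> N" using disjoint_card_bound by blast
  show ?thesis
  proof (rule ccontr)
    assume "\<nexists>a. atom a"
    from disjoint_system_if_no_atom[OF this P_in_F P_nonneg[OF g(1)] P_strict[OF g], of "Suc N"]
    obtain A where "disjoint_system A" "card A = Suc N" by blast
    thus False using N by auto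
  qed
qed

text \<open>If \<open>x\<close> and \<open>z\<close> were disjoint, \<open>inf x b\<close> and
  \<open>inf b z\<close> would be disjoint nonzero parts of the atom \<open>b\<close>.\<close>

lemma atom_meets_trans:
  assumes b: "atom b" and "x \<in> F" "z \<in> F" "0 \<le> x" "0 \<le> z" "inf x b \<noteq> 0" "inf b z \<noteq> 0"
  shows "inf x z \<noteq> 0"
proof
  assume xz: "inf x z = 0"
  have "inf (inf x b) (inf b z) = 0"
  proof (rule antisym)
    have "inf (inf x b) (inf b z) \<le> inf x z" by (intro inf_mono) auto
    thus "inf (inf x b) (inf b z) \<le> 0" using xz by simp
    show "0 \<le> inf (inf x b) (inf b z)" using assms atomD[OF b] by simp
  qed
  hence "inf x b = 0 \<or> inf b z = 0"
    using atomD(1,2)[OF b] assms by (intro atomD(4)[OF b] F_inf) auto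
  thus False using assms by simp
qed

text \<open>The inverse of \<open>S t\<close> on \<open>F\<close> carries disjoint parts of
  \<open>S t a\<close> back to disjoint parts of \<open>a\<close>.\<close>

lemma atom_S:
  assumes a: "atom a" and t: "0 < t"
  shows "atom (S t a)"
proof -
  obtain W where "mono (blinfun_apply W)" and inv: "\<forall>x\<in>F. W (S t x) = x \<and> S t (W x) = x \<and> W x \<in> F"
    using S_inverse[OF t] by blast
  hence Wmono: "W f \<le> W g" if "f \<le> g" for f g using that by (simp add: monoD)
  have W: "W (S t x) = x" "S t (W x) = x" "W x \<in> F" if "x \<in> F" for x using inv that by auto
  have "x = 0 \<or> y = 0" if xy: "x \<in> F" "y \<in> F" "0 \<le> x" "x \<le> S t a" "0 \<le> y" "y \<le> S t a" "inf x y = 0" for x y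
  proof -
    have le: "W x \<le> a" "W y \<le> a" using Wmono[OF xy(4)] Wmono[OF xy(6)] W(1)[OF atomD(1)[OF a]] by auto
    have pos: "0 \<le> W x" "0 \<le> W y" using Wmono[OF xy(3)] Wmono[OF xy(5)] by auto
    have WF: "W x \<in> F" "W y \<in> F" using W(3) xy(1,2) by auto
    have "S t (inf (W x) (W y)) = 0" using S_inf[OF t WF] W(2)[OF xy(1)] W(2)[OF xy(2)] xy(7) by simp
    hence "inf (W x) (W y) = 0" using S_eq_0[OF t F_inf[OF WF]] by blast
    hence "W x = 0 \<or> W y = 0" using atomD(4)[OF a WF pos(1) le(1) pos(2) le(2)] by blast
    thus ?thesis using W(2)[OF xy(1)] W(2)[OF xy(2)] by auto
  qed
  moreover have "S t a \<noteq> 0" using S_eq_0[OF t] atomD[OF a] by blast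
  ultimately show ?thesis
    unfolding atom_def using F_S[OF atomD(1)[OF a] t] S_nonneg[OF t atomD(2)[OF a]] by blast
qed

text \<open>By total boundedness \<open>S (i \<tau>) a\<close> and \<open>S (j \<tau>) a\<close> meet for some \<open>1 \<le> i < j \<le> N + 1\<close>. As \<open>j - i\<close>
  divides \<open>N!\<close>, the choice \<open>\<tau> = t / N!\<close> makes \<open>t\<close> a multiple of \<open>(j - i) \<tau>\<close>.\<close>

lemma atom_meets_S:
  assumes a: "atom a" and t: "0 < t"
  shows "inf a (S t a) \<noteq> 0"
proof -
  obtain N where N: "\<forall>A. disjoint_system A \<longrightarrow> card A \<le> N" using disjoint_card_bound by blast
  define \<tau> where "\<tau> = t / fact N"
  have \<tau>: "\<tau> > 0" using t by (simp add: \<tau>_def)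
  define x where "x i = S (real i * \<tau>) a" for i :: nat
  have x: "atom (x i)" if "i \<ge> 1" for i using atom_S[OF a] \<tau> that by (simp add: x_def)
  have "\<exists>i j. 1 \<le> i \<and> i < j \<and> j \<le> Suc N \<and> inf (x i) (x j) \<noteq> 0"
  proof (rule ccontr)
    assume neg: "\<not> ?thesis"
    have disj: "inf (x i) (x j) = 0" if "i \<in> {1..Suc N}" "j \<in> {1..Suc N}" "i \<noteq> j" for i j
    proof (cases "i < j")
      case True thus ?thesis using neg that by auto
    next
      case False
      hence "inf (x j) (x i) = 0" using neg that by auto
      thus ?thesis by (simp add: inf_commute)
    qed
    \<comment> \<open>Coinciding terms would be disjoint from themselves, hence zero; so the system
      really has \<open>Suc N\<close> members.\<close>
    have "inj_on x {1..Suc N}"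
    proof (rule inj_onI, rule ccontr)
      fix i j assume ij: "i \<in> {1..Suc N}" "j \<in> {1..Suc N}" "x i = x j" "i \<noteq> j"
      hence "x i = 0" using disj[OF ij(1,2,4)] by simp
      thus False using x[of i] ij(1) atomD(3) by auto
    qed
    hence "card (x ` {1..Suc N}) = Suc N" by (simp add: card_image)
    moreover have "x i \<in> F \<and> 0 \<le> x i \<and> x i \<noteq> 0" if "i \<in> {1..Suc N}" for i
      using x[of i] atomD that by auto
    hence "disjoint_system (x ` {1..Suc N})"
      using disj unfolding disjoint_system_def pairwise_image by (auto simp: pairwise_def)
    hence "card (x ` {1..Suc N}) \<le> N" using N by blast
    ultimately show False by simp
  qed
  then obtain i j where ij: "1 \<le> i" "i < j" "j \<le> Suc N" "inf (x i) (x j) \<noteq> 0" by blast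
  define d where "d = j - i"
  have d: "1 \<le> d" "d \<le> N" using ij by (auto simp: d_def)
  define \<sigma> where "\<sigma> = real d * \<tau>"
  have \<sigma>: "\<sigma> > 0" using d \<tau> by (simp add: \<sigma>_def)
  have i\<tau>: "real i * \<tau> > 0" using ij \<tau> by simp
  have aS: "a \<in> F" "S s a \<in> F" "0 \<le> a" "0 \<le> S s a" if "s > 0" for s
    using atomD(1,2)[OF a] atomD(1,2)[OF atom_S[OF a that]] by auto
  \<comment> \<open>Applying the lattice homomorphism \<open>S (real i * \<tau>)\<close> to
    \<open>a\<close> and \<open>S \<sigma> a\<close> gives \<open>x i\<close> and
    \<open>x j\<close>, which are not disjoint.\<close>
  have meet1: "inf a (S \<sigma> a) \<noteq> 0"
  proof
    assume "inf a (S \<sigma> a) = 0"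
    hence "inf (S (real i * \<tau>) a) (S (real i * \<tau>) (S \<sigma> a)) = 0"
      using S_inf[OF i\<tau> aS(1,2)[OF \<sigma>]] by simp
    moreover have "real i * \<tau> + \<sigma> = real j * \<tau>" using ij(2) by (simp add: \<sigma>_def d_def of_nat_diff algebra_simps)
    hence "S (real i * \<tau>) (S \<sigma> a) = x j" using S_add[OF i\<tau> \<sigma>, of a] by (simp add: x_def)
    ultimately show False using ij(4) by (simp add: x_def)
  qed
  \<comment> \<open>The image of the induction hypothesis under \<open>S \<sigma>\<close> says that
    \<open>S \<sigma> a\<close> meets the next term; since \<open>S \<sigma> a\<close> is an atom
    that also meets \<open>a\<close>, transitivity applies.\<close>
  have meet: "inf a (S (real (Suc m) * \<sigma>) a) \<noteq> 0" for m
  proof (induction m)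
    case 0 thus ?case using meet1 by simp
  next
    case (Suc m)
    let ?r = "real (Suc m) * \<sigma>"
    have r: "?r > 0" using \<sigma> by simp
    have r2: "real (Suc (Suc m)) * \<sigma> = \<sigma> + ?r" by (simp add: algebra_simps)
    have "inf (S \<sigma> a) (S \<sigma> (S ?r a)) \<noteq> 0"
      using S_inf[OF \<sigma> aS(1,2)[OF r]] S_eq_0[OF \<sigma> F_inf[OF aS(1,2)[OF r]]] Suc.IH by metis
    hence "inf (S \<sigma> a) (S (\<sigma> + ?r) a) \<noteq> 0" unfolding S_add[OF \<sigma> r] .
    moreover have "\<sigma> + ?r > 0" using \<sigma> r by linarith
    ultimately show ?case unfolding r2
      using atom_meets_trans[OF atom_S[OF a \<sigma>] aS(1)[OF \<sigma>] aS(2) aS(3)[OF \<sigma>] aS(4) meet1] by blast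
  qed
  have "d dvd fact N" using d by (simp add: dvd_fact)
  then obtain m where m: "fact N = d * m" by blast
  hence "m \<noteq> 0" by (metis fact_nonzero mult_0_right)
  then obtain m' where m': "m = Suc m'" using not0_implies_Suc by blast
  have "real m * \<sigma> = real (fact N) * \<tau>" unfolding m \<sigma>_def by simp
  also have "\<dots> = t" by (simp add: \<tau>_def)
  finally show ?thesis using meet[of m'] m' by simp
qed

text \<open>Removing \<open>inf x (c *\<^sub>R a)\<close> from both vectors leaves disjoint
  remainders, nonzero if the vectors are incomparable. Up to scaling they are parts of
  \<open>x\<close> and \<open>a\<close>, and transitivity through the meeting atoms makes them meet,
  a contradiction.\<close>

lemma meeting_atoms_comparable:
  assumes a: "atom a" and x: "atom x" and ax: "inf a x \<noteq> 0" and c: "0 < c"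
  shows "x \<le> c *\<^sub>R a \<or> c *\<^sub>R a \<le> x"
proof (rule ccontr)
  assume neg: "\<not> ?thesis"
  have ca: "c *\<^sub>R a \<in> F" "0 \<le> c *\<^sub>R a" using atomD[OF a] c F_scaleR by (auto intro: scaleR_nonneg_nonneg)
  define p where "p = x - inf x (c *\<^sub>R a)"
  define q where "q = c *\<^sub>R a - inf x (c *\<^sub>R a)"
  have pq0: "p \<noteq> 0" "q \<noteq> 0" using neg unfolding p_def q_def by (metis eq_iff_diff_eq_0 inf_le1 inf_le2)+
  have pos: "0 \<le> p" "0 \<le> q" unfolding p_def q_def diff_ge_0_iff_ge by (rule inf_le1 inf_le2)+
  have F: "p \<in> F" "q \<in> F" unfolding p_def q_def by (intro F_diff F_inf ca atomD(1)[OF x])+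
  have "0 \<le> inf x (c *\<^sub>R a)" using ca atomD(2)[OF x] by simp
  from diff_left_mono[OF this] have le: "p \<le> x" "q \<le> c *\<^sub>R a"
    unfolding p_def q_def diff_zero by blast+
  have pq: "inf p q = 0" unfolding p_def q_def by (rule inf_diff_inf_eq_0)
  define r where "r = (1 / c) *\<^sub>R q"
  have r: "r \<in> F" "0 \<le> r" "r \<noteq> 0" using F pos pq0 c by (auto simp: r_def F_scaleR intro: scaleR_nonneg_nonneg)
  have "r \<le> (1 / c) *\<^sub>R c *\<^sub>R a" unfolding r_def using le c by (intro scaleR_left_mono) auto
  hence ra: "r \<le> a" using c by simp
  have pr: "inf r p = 0"
    using inf_scaleR_eq_0[OF pos(2,1), of "1 / c" 1] pq c by (simp add: r_def inf_commute)
  have "inf r a \<noteq> 0" using ra r by (simp add: inf.absorb1)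
  hence "inf r x \<noteq> 0" using atom_meets_trans[OF a r(1) _ r(2)] ax atomD[OF x] by blast
  moreover have "inf x p \<noteq> 0" using le pq0 by (simp add: inf.absorb2)
  ultimately have "inf r p \<noteq> 0" using atom_meets_trans[OF x r(1) F(1) r(2) pos(1)] by blast
  thus False using pr by simp
qed

text \<open>Take the largest \<open>c\<close> with \<open>c *\<^sub>R a \<le> x\<close>. Beyond
  \<open>c\<close> comparability reverses the inequality, and the closed cone allows passing to the
  limit from both sides.\<close>

lemma meeting_atoms_proportional:
  assumes a: "atom a" and x: "atom x" and ax: "inf a x \<noteq> 0"
  obtains c where "x = c *\<^sub>R a"
proof -
  define Z where "Z = {c. 0 \<le> c \<and> c *\<^sub>R a \<le> x}"
  have Z0: "0 \<in> Z" using atomD[OF x] by (simp add: Z_def)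
  have na: "norm a > 0" using atomD[OF a] by simp
  have "z \<le> norm x / norm a" if "z \<in> Z" for z
  proof -
    have "norm (z *\<^sub>R a) \<le> norm x"
      using that atomD[OF a] by (intro norm_mono_nonneg) (auto simp: Z_def intro: scaleR_nonneg_nonneg)
    thus ?thesis using that na by (simp add: Z_def field_simps)
  qed
  hence bdd: "bdd_above Z" by (rule bdd_aboveI)
  define c where "c = Sup Z"
  have c0: "0 \<le> c" unfolding c_def using Z0 bdd by (rule cSup_upper)
  have lower: "(c - e) *\<^sub>R a \<le> x" if "e > 0" for e
  proof -
    have "Z \<noteq> {}" "c - e < Sup Z" using Z0 that by (auto simp: c_def)
    then obtain z where z: "z \<in> Z" "c - e < z" by (meson less_cSupE)
    have "(c - e) *\<^sub>R a \<le> z *\<^sub>R a" using z(2) atomD(2)[OF a] by (intro scaleR_right_mono) auto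
    thus ?thesis using z(1) by (auto simp: Z_def)
  qed
  have upper: "x \<le> (c + e) *\<^sub>R a" if "e > 0" for e
  proof -
    have "c + e \<notin> Z" using cSup_upper[OF _ bdd, of "c + e"] that by (auto simp: c_def)
    hence "\<not> (c + e) *\<^sub>R a \<le> x" using c0 that by (simp add: Z_def)
    thus ?thesis using meeting_atoms_comparable[OF a x ax, of "c + e"] c0 that by auto
  qed
  have "x = c *\<^sub>R a"
  proof (rule antisym)
    have "(\<lambda>n. (c + 1 / real (Suc n)) *\<^sub>R a) \<longlonglongrightarrow> (c + 0) *\<^sub>R a"
      by (intro tendsto_intros LIMSEQ_inverse_real_of_nat[unfolded inverse_eq_divide])
    thus "x \<le> c *\<^sub>R a" using tendsto_lattice_mono[OF tendsto_const[of x], of "\<lambda>n. (c + 1 / real (Suc n)) *\<^sub>R a"] upper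
      by simp
    have "(\<lambda>n. (c - 1 / real (Suc n)) *\<^sub>R a) \<longlonglongrightarrow> (c - 0) *\<^sub>R a"
      by (intro tendsto_intros LIMSEQ_inverse_real_of_nat[unfolded inverse_eq_divide])
    thus "c *\<^sub>R a \<le> x" using tendsto_lattice_mono[OF _ tendsto_const[of x], of "\<lambda>n. (c - 1 / real (Suc n)) *\<^sub>R a"] lower
      by simp
  qed
  thus ?thesis using that by blast
qed

text \<open>\<open>S s a\<close> is a positive multiple \<open>c s\<close> of \<open>a\<close>.
  Boundedness of powers gives \<open>c s \<le> 1\<close>. Conversely \<open>a = P a\<close> is a
  limit of vectors \<open>S (s n) a\<close>, whose norms are eventually at most
  \<open>c t * norm a\<close>, so \<open>c t \<ge> 1\<close>.\<close>

lemma atom_fixed: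
  assumes a: "atom a" and t: "0 < t"
  shows "S t a = a"
proof -
  have na: "norm a > 0" using atomD[OF a] by simp
  have "\<exists>c. S s a = c *\<^sub>R a \<and> 0 < c \<and> c \<le> 1" if s: "0 < s" for s
  proof -
    obtain c where c: "S s a = c *\<^sub>R a"
      using meeting_atoms_proportional[OF a atom_S[OF a s] atom_meets_S[OF a s]] by blast
    have "c > 0"
    proof (rule ccontr)
      assume "\<not> c > 0"
      hence "c *\<^sub>R a \<le> 0" using atomD(2)[OF a] by (intro scaleR_nonpos_nonneg) auto
      moreover have "0 \<le> c *\<^sub>R a" "c *\<^sub>R a \<noteq> 0" using atomD(2,3)[OF atom_S[OF a s]] unfolding c by auto
      ultimately show False by simp
    qed
    moreover have "c \<le> 1"
    proof (rule ccontr)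
      assume c1: "\<not> c \<le> 1"
      obtain C where C: "0 < C" "\<And>t. 0 < t \<Longrightarrow> norm (S t) \<le> C" using bounded_S by blast
      have pow: "S (real (Suc n) * s) a = c ^ Suc n *\<^sub>R a" for n
      proof (induction n)
        case (Suc n)
        have "real (Suc (Suc n)) * s = s + real (Suc n) * s" by (simp add: algebra_simps)
        hence "S (real (Suc (Suc n)) * s) a = S s (S (real (Suc n) * s) a)"
          using S_add[OF s, of "real (Suc n) * s"] s by simp
        thus ?case using Suc.IH c by (simp add: blinfun.scaleR_right)
      qed (simp add: c)
      obtain n where n: "C < c ^ n" using real_arch_pow[of c C] c1 by auto
      have "norm (S (real (Suc n) * s) a) \<le> C * norm a"
        using norm_blinfun[of "S (real (Suc n) * s)" a] C(2)[of "real (Suc n) * s"] s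
        by (meson mult_pos_pos mult_right_mono norm_ge_zero of_nat_0_less_iff order_trans zero_less_Suc)
      hence "c ^ Suc n \<le> C" unfolding pow using na \<open>c > 0\<close> by simp
      moreover have "c ^ n \<le> c ^ Suc n" using c1 by (intro power_increasing) auto
      ultimately show False using n by linarith
    qed
    ultimately show ?thesis using c by blast
  qed
  then obtain c where c: "\<And>s. 0 < s \<Longrightarrow> S s a = c s *\<^sub>R a" "\<And>s. 0 < s \<Longrightarrow> 0 < c s" "\<And>s. 0 < s \<Longrightarrow> c s \<le> 1"
    by metis
  obtain s where s: "filterlim s at_top sequentially" "(\<lambda>n. S (s n)) \<longlonglongrightarrow> P"
    using P_limit unfolding limit_points_def by blast
  have "(\<lambda>n. norm (S (s n) a)) \<longlonglongrightarrow> norm (P a)"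
    by (intro tendsto_norm blinfun_lim_apply s)
  moreover have "P a = a" using atomD(1)[OF a] by (simp add: F_def)
  moreover have "eventually (\<lambda>n. norm (S (s n) a) \<le> c t * norm a) sequentially"
  proof -
    have "eventually (\<lambda>n. s n > t) sequentially" using s(1) by (simp add: filterlim_at_top_dense)
    thus ?thesis
    proof eventually_elim
      case (elim n)
      have "S (s n) a = S t (S (s n - t) a)" using S_add[of t "s n - t" a] t elim by simp
      also have "\<dots> = (c (s n - t) * c t) *\<^sub>R a" using c(1) t elim by (simp add: blinfun.scaleR_right)
      finally have "norm (S (s n) a) = (c (s n - t) * c t) * norm a"
        using c(2)[OF t] c(2)[of "s n - t"] elim by (simp add: abs_mult)
      moreover have "c (s n - t) * c t \<le> 1 * c t" using c(3)[of "s n - t"] c(2)[OF t] elim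
        by (intro mult_right_mono) auto
      ultimately show ?case using na mult_right_mono[of "c (s n - t) * c t" "c t" "norm a"] by simp
    qed
  qed
  ultimately have "norm a \<le> c t * norm a" by (metis tendsto_upperbound trivial_limit_sequentially)
  hence "c t = 1" using na c(3)[OF t] by simp
  thus ?thesis using c(1)[OF t] by simp
qed

section \<open>Convergence\<close>

text \<open>Otherwise a nonzero positive functional vanishes at \<open>u\<close>, hence on its
  constant orbit, against irreducibility.\<close>

lemma fixed_quasi_interior:
  assumes "0 \<le> u" "u \<noteq> 0" "\<And>t. 0 < t \<Longrightarrow> S t u = u"
  shows "quasi_interior u"
proof (rule ccontr)
  assume "\<not> quasi_interior u"
  then obtain v where v: "0 \<le> v" "\<not> (\<lambda>n. inf v (real n *\<^sub>R u)) \<longlonglongrightarrow> v"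
    using assms(1) unfolding quasi_interior_def by blast
  obtain \<phi> where \<phi>: "positive_functional \<phi>" "\<phi> u = 0" "0 < \<phi> v"
    using positive_functional_separating[OF assms(1) v] by blast
  have "\<phi> \<noteq> 0" using \<phi>(3) by auto
  then obtain t where "0 < t" "0 < \<phi> (S t u)"
    using irreducible assms(1,2) \<phi>(1) unfolding irreducible_semigroup_def by blast
  thus False using assms(3) \<phi>(2) by simp
qed

text \<open>The quasi-interior atom \<open>a\<close> meets every nonzero positive vector, so
  disjoint nonzero parts of \<open>x\<close> would cut out disjoint nonzero parts of
  \<open>a\<close>. Hence a nonzero \<open>x\<close> is itself an atom meeting
  \<open>a\<close>.\<close>

lemma F_one_dimensional:
  assumes a: "atom a" and x: "x \<in> F" "0 \<le> x"
  shows "\<exists>c. x = c *\<^sub>R a"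
proof (cases "x = 0")
  case False
  have qi: "quasi_interior a"
    using fixed_quasi_interior[of a] atom_fixed[OF a] atomD[OF a] by blast
  have meets: "inf y a \<noteq> 0" if y: "0 \<le> y" "y \<noteq> 0" for y
  proof
    assume 0: "inf y a = 0"
    have "inf y (real (Suc n) *\<^sub>R a) = 0" for n
      using inf_scaleR_eq_0[OF y(1) atomD(2)[OF a] 0, of 1 "real (Suc n)"] by simp
    moreover have "(\<lambda>n. inf y (real (Suc n) *\<^sub>R a)) \<longlonglongrightarrow> y"
      using qi y(1) unfolding quasi_interior_def by (intro LIMSEQ_Suc) blast
    ultimately show False using y(2) by (simp add: LIMSEQ_const_iff)
  qed
  have "atom x"
    unfolding atom_def
  proof (intro conjI ballI impI)
    fix y z assume yz: "y \<in> F" "z \<in> F" "0 \<le> y" "y \<le> x" "0 \<le> z" "z \<le> x" "inf y z = 0"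
    have "inf (inf y a) (inf z a) \<le> inf y z" by (intro inf_mono) auto
    hence "inf (inf y a) (inf z a) = 0" using yz atomD[OF a] by (intro antisym) auto
    hence "inf y a = 0 \<or> inf z a = 0"
      using yz atomD(1,2)[OF a] by (intro atomD(4)[OF a] F_inf) auto
    thus "y = 0 \<or> z = 0" using meets yz by blast
  qed (use x False in auto)
  moreover have "inf a x \<noteq> 0" using meets[OF x(2) False] by (simp add: inf_commute)
  ultimately show ?thesis using meeting_atoms_proportional[OF a] by blast
next
  case True
  thus ?thesis by (intro exI[of _ 0]) simp
qed

lemma P_multiple_of_atom:
  assumes "atom a"
  shows "\<exists>c. P f = c *\<^sub>R a"
proof -
  obtain c d where "P (pprt f) = c *\<^sub>R a" "P (pprt (- f)) = d *\<^sub>R a"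
    using F_one_dimensional[OF assms P_in_F P_nonneg] zero_le_pprt by metis
  moreover have "P f = P (pprt f) - P (pprt (- f))"
    using prts[of f] pprt_neg[of f] by (metis blinfun.diff_right diff_minus_eq_add)
  ultimately have "P f = (c - d) *\<^sub>R a" by (simp add: scaleR_left_diff_distrib)
  thus ?thesis by blast
qed

lemma S_P_eq_P:
  assumes "0 < t"
  shows "S t o\<^sub>L P = P"
proof (rule blinfun_eqI)
  fix x
  obtain a where a: "atom a" using atom_exists by blast
  obtain c where "P x = c *\<^sub>R a" using P_multiple_of_atom[OF a] by blast
  thus "(S t o\<^sub>L P) x = P x" using atom_fixed[OF a assms] by (simp add: blinfun.scaleR_right)
qed

text \<open>Along any times tending to infinity some subsequence has a limit point \<open>R\<close>.
  The unit property gives \<open>R o\<^sub>L P = R\<close>, while \<open>S t o\<^sub>L P = P\<close>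
  gives \<open>R o\<^sub>L P = P\<close>.\<close>

lemma S_tendsto_P: "(S \<longlongrightarrow> P) at_top"
proof (rule ccontr)
  assume "\<not> ?thesis"
  then obtain e where e: "e > 0" "\<not> eventually (\<lambda>t. dist (S t) P < e) at_top"
    unfolding tendsto_iff by blast
  hence "\<exists>t\<ge>real n + 1. \<not> dist (S t) P < e" for n
    unfolding eventually_at_top_linorder by blast
  then obtain t where t: "\<And>n. real n + 1 \<le> t n" "\<And>n. \<not> dist (S (t n)) P < e" by metis
  have t0: "0 < t n" for n using t(1)[of n] by linarith
  have "real n \<le> t n" for n using t(1)[of n] by linarith
  hence "filterlim t at_top sequentially"
    by (intro filterlim_at_top_mono[OF filterlim_real_sequentially] always_eventually allI)
  then obtain R k where R: "R \<in> limit_points" "strict_mono k" "(\<lambda>n. S (t (k n))) \<longlonglongrightarrow> R"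
    using convergent_subseq[of t] t0 by blast
  have "(\<lambda>n. S (t (k n)) o\<^sub>L P) \<longlonglongrightarrow> (R o\<^sub>L P)"
    by (intro bounded_bilinear.tendsto[OF bounded_bilinear_blinfun_compose] tendsto_const R)
  hence "R o\<^sub>L P = P" using S_P_eq_P[OF t0] by (simp add: LIMSEQ_const_iff)
  moreover have "R o\<^sub>L P = R" using limit_point_commute[OF R(1) P_limit] P_unit[OF R(1)] by simp
  ultimately have "(\<lambda>n. S (t (k n))) \<longlonglongrightarrow> P" using R(3) by simp
  hence "eventually (\<lambda>n. dist (S (t (k n))) P < e) sequentially" using e(1) by (rule tendstoD)
  thus False using t(2) by (auto simp: eventually_sequentially)
qed

lemma S_tendsto_rank_one:
  "\<exists>u \<phi>. quasi_interior u \<and> strictly_positive_functional \<phi> \<and> (S \<longlongrightarrow> rank_one \<phi> u) at_top"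
proof -
  obtain a where a: "atom a" using atom_exists by blast
  obtain \<psi> where \<psi>: "positive_functional \<psi>" "0 < \<psi> a"
    using positive_functional_exists[OF atomD(2,3)[OF a]] by blast
  \<comment> \<open>Dividing by \<open>\<psi> a\<close> makes \<open>\<phi> f\<close> the
    coefficient of \<open>P f\<close> with respect to \<open>a\<close>.\<close>
  define \<phi> where "\<phi> = (1 / \<psi> a) *\<^sub>R (\<psi> o\<^sub>L P)"
  have Pf: "P f = \<phi> f *\<^sub>R a" for f
  proof -
    obtain c where c: "P f = c *\<^sub>R a" using P_multiple_of_atom[OF a] by blast
    hence "\<phi> f = c" using \<psi>(2) by (simp add: \<phi>_def blinfun.scaleR_left blinfun.scaleR_right)
    thus ?thesis using c by simp
  qed
  have "strictly_positive_functional \<phi>"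
    unfolding strictly_positive_functional_def
  proof safe
    fix f :: 'a assume f: "0 \<le> f" "f \<noteq> 0"
    have "0 \<le> \<phi> f"
      using \<psi> P_nonneg[OF f(1)] by (simp add: \<phi>_def blinfun.scaleR_left positive_functional_def)
    moreover have "\<phi> f \<noteq> 0" using P_strict[OF f] Pf[of f] by auto
    ultimately show "0 < \<phi> f" by simp
  qed
  moreover have "quasi_interior a"
    using fixed_quasi_interior[of a] atom_fixed[OF a] atomD[OF a] by blast
  \<comment> \<open>By \<open>Pf\<close> the function inside \<open>Blinfun\<close> is that of
    \<open>P\<close>, so \<open>rank_one \<phi> a\<close> is literally \<open>P\<close>.\<close>
  moreover have "(S \<longlongrightarrow> rank_one \<phi> a) at_top"
    using S_tendsto_P unfolding rank_one_def Pf[symmetric] blinfun_apply_inverse .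
  ultimately show ?thesis by blast
qed

end

theorem theorem3p4:
  fixes S :: "real \<Rightarrow> ('a::banach_lattice \<Rightarrow>\<^sub>L 'a)"
  assumes "op_semigroup S"
    and "positive_semigroup S"
    and "irreducible_semigroup S"
    and "growth_bound S = 0"
    and "asymptotically_compact S"
  shows "\<exists>u \<phi>. quasi_interior u \<and> strictly_positive_functional \<phi> \<and>
           (S \<longlongrightarrow> rank_one \<phi> u) at_top"
proof -
  interpret irreducible_compact_semigroup S
    using assms by unfold_locales
  obtain P where "P \<in> limit_points" "\<And>Q. Q \<in> limit_points \<Longrightarrow> P o\<^sub>L Q = Q"
    using limit_point_unit by blast
  then interpret limit_projection S P by unfold_locales
  show ?thesis by (rule S_tendsto_rank_one)
qed

end
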